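(* Let $\Omega=\mathbb T^3$ with $|\Omega|=1$, and let $\varepsilon>0$, $r_2>0$. Let $p(\rho)=a\rho^\gamma$ with $a>0$, $\gamma\ge 1$, and let the shear viscosity $\mu$ and bulk viscosity $\lambda$ satisfy the viscosity assumptions (V1)--(V5) listed in the context. Let $(\rho,u)$ be a global weak solution of the compressible Navier--Stokes--Korteweg system with drag term $r_2\rho u$, in the sense of the definition given in the context, with associated $\kappa\in(0,1)$ and with $r=\int_\Omega\rho>0$ the mean value of $\rho$ on $\Omega$. Define the relative entropy $$\mathcal E(t)=\mathcal E(\rho,u,v\,|\,r,0,0)=\int_\Omega\Big[\rho\big(|w|^2+(\kappa(1-\kappa)+\varepsilon)|v|^2\big)+H(\rho|r)+2\kappa r_2\,h(\rho|r)\Big],$$ where $v=2\nabla s(\rho)$, $s'(\rho)=\mu'(\rho)/\rho$, $w=u+\kappa v$, and $$H(\rho)=\rho\int_1^\rho\frac{p(\tau)}{\tau^2}\,d\tau,\qquad h(\rho)=\rho\int_1^\rho\frac{\mu(\tau)}{\tau^2}\,d\tau,$$ $$H(\rho|r)=H(\rho)-H(r)-H'(r)(\rho-r),\qquad h(\rho|r)=h(\rho)-h(r)-h'(r)(\rho-r).$$ Then there is a constant $C>0$, independent of $t$, such that for $t>0$ $$\mathcal E(t)\le \mathcal E(0)\exp(-Ct).$$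
   Context: **Viscosity assumptions.** (V1) $\lambda(\rho)=2(\rho\mu'(\rho)-\mu(\rho))$ and $\mu\in C^0([0,\infty);[0,\infty))\cap C^2((0,\infty);\mathbb R)$. (V2) There are $2/3<\alpha_1<\alpha_2<4$ such that for all $\rho>0$: $0<\frac1{\alpha_2}\rho\mu'(\rho)\le\mu(\rho)\le\frac1{\alpha_1}\rho\mu'(\rho)$. (V3) There is a constant such that $|\rho\mu''(\rho)/\mu'(\rho)|\le C<+\infty$ for all $\rho>0$. By (V2), (V3) there is $\tilde\nu>0$ with $\lambda(\rho)+\frac23\mu(\rho)\ge\tilde\nu\mu(\rho)$, and $\mu(0)=\lambda(0)=0$. (V4) (small densities) $\lim_{\rho\to0}\rho\mu'(\rho)/\mu(\rho)=\alpha$ with $2/3<\alpha\le4$, and one of the following holds: (i) $\alpha<1$, or there exist $\bar\rho>0$, $c>0$ such that $\mu(\rho)\ge c\rho$ for $\rho<\bar\rho$; in this case $\gamma\ge1$ is arbitrary; (ii) $\alpha\ge1$ and $\gamma<\alpha$. (V5) (large densities) Either $\lim_{\rho\to\infty}\rho\mu'(\rho)/\mu(\rho)=\beta$ with $1<\beta<4$, or there is a given constant $M_0>0$ such that $\mu(\rho)=\rho$ for all $\rho\ge M_0$. **Notation.** Integrals $\int_\Omega$ are with respect to Lebesgue measure $dx$. $v,w,s,H,h$ are as in the claim, and $$Z(\rho)=\int_1^\rho\frac{\sqrt{\mu(\tau)}\,\mu'(\tau)}{\tau}\,d\tau,\qquad Z_1(\rho)=\int_1^\rho\frac{\mu'(\tau)}{\mu(\tau)^{1/4}\tau^{1/2}}\,d\tau.$$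 $\mathcal C^0([0,\infty);L^q_{\rm weak})$ denotes continuity in time for the weak topology of $L^q$. $L^{1+}$ denotes $L^q$ for some $q>1$. **Definition of global weak solution** (with initial data $\rho^0$, $m^0$, and initial values $w_0,v_0$ of $w,v$). $(\rho,u)$ is a global weak solution if: 1. $\rho\in\mathcal C^0([0,\infty);L^\gamma_{\rm weak}(\Omega))$, $\rho\ge0$ in $(0,\infty)\times\Omega$, $\rho|_{t=0}=\rho^0$ a.e. in $\Omega$, and $\mu(\rho)\in\mathcal C^0([0,\infty);L^{3/2}_{\rm weak}(\Omega))$. 2. $\rho u\in\mathcal C([0,\infty);L^{2\gamma/(\gamma+1)}_{\rm weak}(\Omega))$ with $\rho u|_{t=0}=m^0$. 3. For some $C_{\alpha_1,\tilde\nu}>0$ depending on $\alpha_1$ and $\tilde\nu$ and some $\kappa\in(0,1)$, for a.e. $t\in[0,\infty)$, $$\begin{aligned}&\int_\Omega\Big[\rho\Big(\tfrac{|w|^2}{2}+[(1-\kappa)\kappa+\varepsilon]\tfrac{|v|^2}{2}\Big)+H(\rho)+2r_2\kappa h(\rho)\Big]+\tilde\nu\int_0^t\!\!\int_\Omega|\mathbb T_\mu|^2+r_2\int_0^t\!\!\int_\Omega\rho|u|^2\\&+\varepsilon C_{\alpha_1,\tilde\nu}\int_0^t\!\!\int_\Omega\big[|\nabla^2Z(\rho)|^2+|\nabla Z_1(\rho)|^4+|\mathbb T_\varepsilon|^2\big]+2\kappa\int_0^t\!\!\int_\Omega\frac{\mu'(\rho)p'(\rho)}{\rho}|\nabla\rho|^2\\&\le\int_\Omega\Big[\rho^0\Big(\tfrac{|w_0|^2}{2}+[(1-\kappa)\kappa+\varepsilon]\tfrac{|v_0|^2}{2}\Big)+H(\rho^0)+2r_2\kappa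 h(\rho^0)\Big],\end{aligned}$$ where $\mathbb T_\mu$ is defined through $$\sqrt{\mu(\rho)}\,\mathbb T_\mu=\nabla\Big(\sqrt\rho u\,\frac{\mu(\rho)}{\sqrt\rho}\Big)-\sqrt\rho u\otimes\sqrt\rho\nabla s(\rho),$$ $$\frac{\lambda(\rho)}{2\mu(\rho)}{\rm Tr}(\sqrt{\mu(\rho)}\mathbb T_\mu){\rm Id}=\Big[{\rm div}\Big(\frac{\lambda(\rho)}{2\mu(\rho)}\sqrt\rho u\frac{\mu(\rho)}{\sqrt\rho}\Big)-\sqrt\rho u\cdot\sqrt\rho\nabla s(\rho)\frac{\rho\mu''(\rho)}{\mu'(\rho)}\Big]{\rm Id},$$ and $\mathbb T_\varepsilon$ satisfies the same two relations with $u$ replaced by $v=2\nabla s(\rho)$. 4. $\mu(\rho)\in L^\infty(0,\infty;W^{1,1}(\Omega))$, $\mu(\rho)u\in L^\infty(0,\infty;L^{3/2}(\Omega))\cap L^2(0,\infty;W^{1,1}(\Omega))$, $\partial_t\mu(\rho)\in L^\infty(0,\infty;W^{-1,1}(\Omega))$, $Z(\rho)\in L^{1+}(0,\infty;L^1(\Omega))$. 5. In $\mathcal D'((0,\infty)\times\Omega)$: $\partial_t\rho+{\rm div}(\rho u)=0$. 6. In $\mathcal D'((0,\infty)\times\Omega)$: $$\begin{aligned}&\partial_t(\rho u)+{\rm div}(\rho u\otimes u)+\nabla p(\rho)+r_2\rho u-2\,{\rm div}\Big(\sqrt{\mu(\rho)}\mathbb S_\mu+\frac{\lambda(\rho)}{2\mu(\rho)}{\rm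 Tr}(\sqrt{\mu(\rho)}\mathbb S_\mu){\rm Id}\Big)\\&-2\varepsilon\,{\rm div}\Big(\sqrt{\mu(\rho)}\mathbb S_\varepsilon+\frac{\lambda(\rho)}{2\mu(\rho)}{\rm Tr}(\sqrt{\mu(\rho)}\mathbb S_\varepsilon){\rm Id}\Big)=0,\end{aligned}$$ with $\mathbb S_\mu=\frac12(\mathbb T_\mu+\mathbb T_\mu^t)$, $\mathbb S_\varepsilon=\frac12(\mathbb T_\varepsilon+\mathbb T_\varepsilon^t)$. 7. In $\mathcal D'((0,\infty)\times\Omega)$: $\partial_t\mu(\rho)+{\rm div}(\mu(\rho)u)+\frac{\lambda(\rho)}{2\mu(\rho)}{\rm Tr}(\sqrt{\mu(\rho)}\mathbb T_\mu)=0$. 8. The global weak solution is obtained, letting $\zeta\to0$, from regularized (regular enough) solutions $(\rho_\zeta,w_\zeta,v_\zeta)$, with $\rho_\zeta\ge0$, $\int_\Omega\rho_\zeta(t)=r$ for all $t$, $v_\zeta=2\nabla s(\rho_\zeta)$, $w_\zeta=u_\zeta+\kappa v_\zeta$, satisfying $$\frac{d\mathcal E_\zeta}{dt}(t)+\varepsilon C_{\tilde\nu,\alpha_1}\int_\Omega|\nabla^2Z(\rho_\zeta)|^2+\kappa\int_\Omega\mu'(\rho_\zeta)H''(\rho_\zeta)|\nabla\rho_\zeta|^2+\int_\Omega r_2\rho_\zeta|u_\zeta|^2\le0,$$ where $$\mathcal E_\zeta(t)=\int_\Omega\Big[\rho_\zeta\big(|w_\zeta|^2+(\kappa(1-\kappa)+\varepsilon)|v_\zeta|^2\big)+H(\rho_\zeta|r)+2r_2\kappa\,h(\rho_\zeta|r)\Big].$$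 **Convention on the limit.** The regularized initial data are assumed to converge strongly, so that $\mathcal E_\zeta(0)\to\mathcal E(0)$, and the energy is lower semicontinuous along the limit $\zeta\to0$: $\mathcal E(t)\le\liminf_{\zeta\to0}\mathcal E_\zeta(t)$. *)

theory Defs
  imports "HOL-Analysis.Analysis"
begin

section \<open>The flat torus of volume one\<close>

text \<open>
  A function on the torus is represented by its 1-periodic lift to \<^typ>\<open>real^3\<close>; integrals are
  taken over the unit cell.  Since all test functions are periodic, weak derivatives with respect
  to the cell are the weak derivatives on the torus (no boundary terms appear).
\<close>

definition cell :: "(real^3) set" where
  "cell = cbox 0 One"

definition torus :: "(real^3) measure" where
  "torus = lebesgue_on cell"

definition spacetime :: "real set \<Rightarrow> (real \<times> (real^3)) measure" where
  "spacetime I = lebesgue_on (I \<times> cell)"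

definition periodic :: "(real^3 \<Rightarrow> 'b) \<Rightarrow> bool" where
  "periodic f \<longleftrightarrow> (\<forall>x k. f (x + axis k 1) = f x)"

text \<open>Functions of class C^k on a finite-dimensional space, via directional derivatives.\<close>

primrec Ck :: "nat \<Rightarrow> ('a::real_normed_vector \<Rightarrow> 'b::real_normed_vector) \<Rightarrow> bool" where
  "Ck 0 f \<longleftrightarrow> continuous_on UNIV f"
| "Ck (Suc k) f \<longleftrightarrow> (\<forall>x. f differentiable (at x)) \<and>
                   (\<forall>d. Ck k (\<lambda>x. frechet_derivative f (at x) d))"

definition pd :: "3 \<Rightarrow> (real^3 \<Rightarrow> real) \<Rightarrow> real^3 \<Rightarrow> real" where
  "pd i f x = frechet_derivative f (at x) (axis i 1)"

definition grad :: "(real^3 \<Rightarrow> real) \<Rightarrow> real^3 \<Rightarrow> real^3" where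
  "grad f x = (\<chi> i. pd i f x)"

definition hess :: "(real^3 \<Rightarrow> real) \<Rightarrow> real^3 \<Rightarrow> real^3^3" where
  "hess f x = (\<chi> i j. pd j (pd i f) x)"

definition outer :: "real^3 \<Rightarrow> real^3 \<Rightarrow> real^3^3" where
  "outer a b = (\<chi> i j. a $ i * b $ j)"


section \<open>Weak derivatives in space\<close>

definition test_space :: "(real^3 \<Rightarrow> real) \<Rightarrow> bool" where
  "test_space \<phi> \<longleftrightarrow> (\<forall>k. Ck k \<phi>) \<and> periodic \<phi>"

definition weak_pd :: "3 \<Rightarrow> (real^3 \<Rightarrow> real) \<Rightarrow> (real^3 \<Rightarrow> real) \<Rightarrow> bool" where
  "weak_pd i f g \<longleftrightarrow> integrable torus f \<and> integrable torus g \<and>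
     (\<forall>\<phi>. test_space \<phi> \<longrightarrow>
        (\<integral>x. f x * pd i \<phi> x \<partial>torus) = - (\<integral>x. g x * \<phi> x \<partial>torus))"

definition weak_grad :: "(real^3 \<Rightarrow> real) \<Rightarrow> (real^3 \<Rightarrow> real^3) \<Rightarrow> bool" where
  "weak_grad f g \<longleftrightarrow> (\<forall>i. weak_pd i f (\<lambda>x. g x $ i))"

text \<open>Row \<open>i\<close> of the Jacobian is the gradient of the \<open>i\<close>-th component; with this convention
  \<open>\<nabla>(f u) = f \<nabla>u + outer u (\<nabla>f)\<close>.\<close>

definition weak_jac :: "(real^3 \<Rightarrow> real^3) \<Rightarrow> (real^3 \<Rightarrow> real^3^3) \<Rightarrow> bool" where
  "weak_jac f G \<longleftrightarrow> (\<forall>i. weak_grad (\<lambda>x. f x $ i) (\<lambda>x. G x $ i))"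

definition weak_hess :: "(real^3 \<Rightarrow> real) \<Rightarrow> (real^3 \<Rightarrow> real^3^3) \<Rightarrow> bool" where
  "weak_hess f M \<longleftrightarrow> (\<exists>g. weak_grad f g \<and> weak_jac g M)"

text \<open>
  \<open>g\<close> is the gradient of \<open>F(\<rho>)\<close>, where \<open>F\<close> is only given on the positive half-line and may be
  singular at the vacuum (as the logarithm, for \<open>F = s\<close> and \<open>\<mu>(\<rho>) = \<rho>\<close>): the weak gradient of
  \<open>F\<close> of the truncation of \<open>\<rho>\<close> to \<open>[\<delta>, M]\<close> is \<open>g\<close> restricted to \<open>{\<delta> < \<rho> < M}\<close>.  The value of
  \<open>g\<close> on the vacuum is set to 0; it always enters multiplied by a quantity vanishing there.
\<close>

definition trunc_grad ::
    "(real \<Rightarrow> real) \<Rightarrow> (real^3 \<Rightarrow> real) \<Rightarrow> (real^3 \<Rightarrow> real^3) \<Rightarrow> bool" where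
  "trunc_grad F \<rho> g \<longleftrightarrow>
     (\<forall>\<delta> M. 0 < \<delta> \<and> \<delta> < M \<longrightarrow>
        weak_grad (\<lambda>x. F (max \<delta> (min M (\<rho> x)))) (\<lambda>x. indicator {\<delta><..<M} (\<rho> x) *\<^sub>R g x)) \<and>
     (AE x in torus. \<rho> x \<le> 0 \<longrightarrow> g x = 0)"


section \<open>Distributions on the half-line of times and the torus\<close>

type_synonym distribution = "(real \<times> (real^3) \<Rightarrow> real) \<Rightarrow> real"

definition test_fun :: "(real \<times> (real^3) \<Rightarrow> real) \<Rightarrow> bool" where
  "test_fun \<phi> \<longleftrightarrow> (\<forall>k. Ck k \<phi>) \<and> (\<forall>t. periodic (\<lambda>x. \<phi> (t, x))) \<and>
     (\<exists>a b. 0 < a \<and> a < b \<and> (\<forall>t x. t \<notin> {a..b} \<longrightarrow> \<phi> (t, x) = 0))"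

definition L1loc :: "(real \<Rightarrow> real^3 \<Rightarrow> 'b::euclidean_space) \<Rightarrow> bool" where
  "L1loc f \<longleftrightarrow> (\<forall>a b. 0 < a \<and> a < b \<longrightarrow> integrable (spacetime {a..b}) (case_prod f))"

definition dist_of :: "(real \<Rightarrow> real^3 \<Rightarrow> real) \<Rightarrow> distribution" where
  "dist_of f \<phi> = (\<integral>z. case_prod f z * \<phi> z \<partial>spacetime {0<..})"

definition Dt :: "distribution \<Rightarrow> distribution" where
  "Dt T \<phi> = - T (\<lambda>z. frechet_derivative \<phi> (at z) (1, 0))"

definition Dx :: "3 \<Rightarrow> distribution \<Rightarrow> distribution" where
  "Dx i T \<phi> = - T (\<lambda>z. frechet_derivative \<phi> (at z) (0, axis i 1))"

definition Div :: "(real \<Rightarrow> real^3 \<Rightarrow> real^3) \<Rightarrow> distribution" where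
  "Div F \<phi> = (\<Sum>i\<in>UNIV. Dx i (dist_of (\<lambda>t x. F t x $ i)) \<phi>)"

definition converges_in_D ::
    "(nat \<Rightarrow> real \<Rightarrow> real^3 \<Rightarrow> 'b::euclidean_space) \<Rightarrow> (real \<Rightarrow> real^3 \<Rightarrow> 'b) \<Rightarrow> bool" where
  "converges_in_D fn f \<longleftrightarrow> (\<forall>n. L1loc (fn n)) \<and> L1loc f \<and>
     (\<forall>\<phi>. test_fun \<phi> \<longrightarrow> (\<forall>b\<in>Basis.
        (\<lambda>n. dist_of (\<lambda>t x. fn n t x \<bullet> b) \<phi>) \<longlonglongrightarrow> dist_of (\<lambda>t x. f t x \<bullet> b) \<phi>))"


section \<open>Function spaces\<close>

definition in_Lq :: "real \<Rightarrow> (real^3 \<Rightarrow> 'b::euclidean_space) \<Rightarrow> bool" where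
  "in_Lq q f \<longleftrightarrow> f \<in> borel_measurable torus \<and> integrable torus (\<lambda>x. norm (f x) powr q)"

text \<open>Membership in the dual space of \<open>L^q\<close>, \<open>1 \<le> q < \<infinity>\<close>.\<close>

definition in_dual_Lq :: "real \<Rightarrow> (real^3 \<Rightarrow> 'b::euclidean_space) \<Rightarrow> bool" where
  "in_dual_Lq q \<psi> \<longleftrightarrow> \<psi> \<in> borel_measurable torus \<and>
     (if q = 1 then \<exists>M. AE x in torus. norm (\<psi> x) \<le> M else in_Lq (q / (q - 1)) \<psi>)"

definition C0_Lq_weak :: "real \<Rightarrow> (real \<Rightarrow> real^3 \<Rightarrow> 'b::euclidean_space) \<Rightarrow> bool" where
  "C0_Lq_weak q f \<longleftrightarrow> (\<forall>t\<ge>0. in_Lq q (f t)) \<and>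
     (\<forall>\<psi>. in_dual_Lq q \<psi> \<longrightarrow> continuous_on {0..} (\<lambda>t. \<integral>x. f t x \<bullet> \<psi> x \<partial>torus))"

text \<open>\<open>L^\<infinity>(0,\<infinity>; L^q)\<close>, and \<open>L^p(I; L^1)\<close> for an interval of times \<open>I\<close>.\<close>

definition in_Linf_Lq :: "real \<Rightarrow> (real \<Rightarrow> real^3 \<Rightarrow> 'b::euclidean_space) \<Rightarrow> bool" where
  "in_Linf_Lq q f \<longleftrightarrow> case_prod f \<in> borel_measurable (spacetime {0<..}) \<and>
     (\<exists>M. AE t in lebesgue_on {0<..}.
        in_Lq q (f t) \<and> (\<integral>x. norm (f t x) powr q \<partial>torus) \<le> M)"

definition in_Lp_L1 :: "real set \<Rightarrow> real \<Rightarrow> (real \<Rightarrow> real^3 \<Rightarrow> 'b::euclidean_space) \<Rightarrow> bool" where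
  "in_Lp_L1 I p f \<longleftrightarrow> case_prod f \<in> borel_measurable (spacetime I) \<and>
     (AE t in lebesgue_on I. integrable torus (f t)) \<and>
     integrable (lebesgue_on I) (\<lambda>t. (\<integral>x. norm (f t x) \<partial>torus) powr p)"

definition in_Linf_W11 :: "(real \<Rightarrow> real^3 \<Rightarrow> real) \<Rightarrow> bool" where
  "in_Linf_W11 f \<longleftrightarrow> in_Linf_Lq 1 f \<and>
     (\<exists>g. in_Linf_Lq 1 g \<and> (AE t in lebesgue_on {0<..}. weak_grad (f t) (g t)))"

definition in_L2_W11 :: "(real \<Rightarrow> real^3 \<Rightarrow> real^3) \<Rightarrow> bool" where
  "in_L2_W11 f \<longleftrightarrow> in_Lp_L1 {0<..} 2 f \<and>
     (\<exists>G. in_Lp_L1 {0<..} 2 G \<and> (AE t in lebesgue_on {0<..}. weak_jac (f t) (G t)))"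

text \<open>\<open>W^{-1,1}\<close> consists of the distributions \<open>g0 + div g\<close> with \<open>g0\<close> and \<open>g\<close> in \<open>L^1\<close>.\<close>

definition in_Linf_Wm11 :: "distribution \<Rightarrow> bool" where
  "in_Linf_Wm11 T \<longleftrightarrow> (\<exists>g0 g. in_Linf_Lq 1 g0 \<and> in_Linf_Lq 1 g \<and>
     (\<forall>\<phi>. test_fun \<phi> \<longrightarrow> T \<phi> = dist_of g0 \<phi> + Div g \<phi>))"


section \<open>Constitutive functions\<close>

definition pressure :: "real \<Rightarrow> real \<Rightarrow> real \<Rightarrow> real" where
  "pressure a \<gamma> \<rho> = a * \<rho> powr \<gamma>"

text \<open>\<open>H\<close> is the case \<open>f = p\<close> and \<open>h\<close> the case \<open>f = \<mu>\<close>.  The integral is oriented.  At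
  \<open>\<rho> = 0\<close> the value is 0, which is the continuous extension for \<open>f = p\<close> and \<open>f = \<mu>\<close>.\<close>

definition potential :: "(real \<Rightarrow> real) \<Rightarrow> real \<Rightarrow> real" where
  "potential f \<rho> = \<rho> * (LBINT \<tau>=1..ereal \<rho>. f \<tau> / \<tau>\<^sup>2)"

definition relative :: "(real \<Rightarrow> real) \<Rightarrow> real \<Rightarrow> real \<Rightarrow> real" where
  "relative F \<rho> r = F \<rho> - F r - deriv F r * (\<rho> - r)"

definition s_fun :: "(real \<Rightarrow> real) \<Rightarrow> real \<Rightarrow> real" where
  "s_fun \<mu> \<rho> = (LBINT \<tau>=1..ereal \<rho>. deriv \<mu> \<tau> / \<tau>)"

definition Z_fun :: "(real \<Rightarrow> real) \<Rightarrow> real \<Rightarrow> real" where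
  "Z_fun \<mu> \<rho> = (LBINT \<tau>=1..ereal \<rho>. sqrt (\<mu> \<tau>) * deriv \<mu> \<tau> / \<tau>)"

definition Z1_fun :: "(real \<Rightarrow> real) \<Rightarrow> real \<Rightarrow> real" where
  "Z1_fun \<mu> \<rho> = (LBINT \<tau>=1..ereal \<rho>. deriv \<mu> \<tau> / (\<mu> \<tau> powr (1/4) * \<tau> powr (1/2)))"

text \<open>The factor \<open>deriv \<mu> 0\<close> is multiplied by 0, so that \<open>lam 0 = - 2 \<mu> 0\<close>.\<close>

definition V1 :: "(real \<Rightarrow> real) \<Rightarrow> (real \<Rightarrow> real) \<Rightarrow> bool" where
  "V1 \<mu> lam \<longleftrightarrow> (\<forall>\<rho>\<ge>0. lam \<rho> = 2 * (\<rho> * deriv \<mu> \<rho> - \<mu> \<rho>)) \<and>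
     continuous_on {0..} \<mu> \<and> (\<forall>\<rho>\<ge>0. 0 \<le> \<mu> \<rho>) \<and>
     (\<forall>\<rho>>0. \<mu> differentiable (at \<rho>) \<and> deriv \<mu> differentiable (at \<rho>)) \<and>
     continuous_on {0<..} (deriv (deriv \<mu>))"

definition V2 :: "(real \<Rightarrow> real) \<Rightarrow> real \<Rightarrow> real \<Rightarrow> bool" where
  "V2 \<mu> \<alpha>1 \<alpha>2 \<longleftrightarrow> 2/3 < \<alpha>1 \<and> \<alpha>1 < \<alpha>2 \<and> \<alpha>2 < 4 \<and>
     (\<forall>\<rho>>0. 0 < 1/\<alpha>2 * (\<rho> * deriv \<mu> \<rho>) \<and>
        1/\<alpha>2 * (\<rho> * deriv \<mu> \<rho>) \<le> \<mu> \<rho> \<and> \<mu> \<rho> \<le> 1/\<alpha>1 * (\<rho> * deriv \<mu> \<rho>))"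

definition V3 :: "(real \<Rightarrow> real) \<Rightarrow> bool" where
  "V3 \<mu> \<longleftrightarrow> (\<exists>C. \<forall>\<rho>>0. \<bar>\<rho> * deriv (deriv \<mu>) \<rho> / deriv \<mu> \<rho>\<bar> \<le> C)"

definition V4 :: "(real \<Rightarrow> real) \<Rightarrow> real \<Rightarrow> bool" where
  "V4 \<mu> \<gamma> \<longleftrightarrow> (\<exists>\<alpha>. ((\<lambda>\<rho>. \<rho> * deriv \<mu> \<rho> / \<mu> \<rho>) \<longlongrightarrow> \<alpha>) (at_right 0) \<and> 2/3 < \<alpha> \<and> \<alpha> \<le> 4 \<and>
     ((\<alpha> < 1 \<or> (\<exists>\<rho>'>0. \<exists>c>0. \<forall>\<rho>. 0 < \<rho> \<and> \<rho> < \<rho>' \<longrightarrow> c * \<rho> \<le> \<mu> \<rho>)) \<or>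
      (1 \<le> \<alpha> \<and> \<gamma> < \<alpha>)))"

definition V5 :: "(real \<Rightarrow> real) \<Rightarrow> bool" where
  "V5 \<mu> \<longleftrightarrow>
     (\<exists>\<beta>. ((\<lambda>\<rho>. \<rho> * deriv \<mu> \<rho> / \<mu> \<rho>) \<longlongrightarrow> \<beta>) at_top \<and> 1 < \<beta> \<and> \<beta> < 4) \<or>
     (\<exists>M0>0. \<forall>\<rho>\<ge>M0. \<mu> \<rho> = \<rho>)"


section \<open>Energies\<close>

definition w_of :: "real \<Rightarrow> (real \<Rightarrow> real^3 \<Rightarrow> real^3) \<Rightarrow> (real \<Rightarrow> real^3 \<Rightarrow> real^3) \<Rightarrow>
    real \<Rightarrow> real^3 \<Rightarrow> real^3" where
  "w_of \<kappa> u v t x = u t x + \<kappa> *\<^sub>R v t x"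

definition energy_density ::
    "(real \<Rightarrow> real) \<Rightarrow> real \<Rightarrow> real \<Rightarrow> real \<Rightarrow> real \<Rightarrow> real \<Rightarrow>
     (real^3 \<Rightarrow> real) \<Rightarrow> (real^3 \<Rightarrow> real^3) \<Rightarrow> (real^3 \<Rightarrow> real^3) \<Rightarrow> real^3 \<Rightarrow> real" where
  "energy_density \<mu> a \<gamma> \<epsilon> r2 \<kappa> \<rho> w v x =
     \<rho> x * ((norm (w x))\<^sup>2 / 2 + ((1 - \<kappa>) * \<kappa> + \<epsilon>) * ((norm (v x))\<^sup>2 / 2))
     + potential (pressure a \<gamma>) (\<rho> x) + 2 * r2 * \<kappa> * potential \<mu> (\<rho> x)"

text \<open>The integrand is nonnegative, because \<open>H\<close> and \<open>h\<close> are convex; the value may be infinite.\<close>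

definition relative_entropy ::
    "(real \<Rightarrow> real) \<Rightarrow> real \<Rightarrow> real \<Rightarrow> real \<Rightarrow> real \<Rightarrow> real \<Rightarrow> real \<Rightarrow>
     (real^3 \<Rightarrow> real) \<Rightarrow> (real^3 \<Rightarrow> real^3) \<Rightarrow> (real^3 \<Rightarrow> real^3) \<Rightarrow> ennreal" where
  "relative_entropy \<mu> a \<gamma> \<epsilon> r2 \<kappa> r \<rho> w v = (\<integral>\<^sup>+x. ennreal (
     \<rho> x * ((norm (w x))\<^sup>2 + (\<kappa> * (1 - \<kappa>) + \<epsilon>) * (norm (v x))\<^sup>2)
     + relative (potential (pressure a \<gamma>)) (\<rho> x) r
     + 2 * \<kappa> * r2 * relative (potential \<mu>) (\<rho> x) r) \<partial>torus)"


section \<open>Viscous tensors\<close>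

text \<open>
  The two relations defining \<open>T\<close>, in the sense of distributions, for a velocity field \<open>u\<close>; here
  \<open>ds\<close> is the gradient of \<open>s(\<rho>)\<close>.  The second relation is an identity between multiples of the
  identity matrix, hence a scalar one.
\<close>

definition viscous_relations ::
    "(real \<Rightarrow> real) \<Rightarrow> (real \<Rightarrow> real) \<Rightarrow> (real \<Rightarrow> real^3 \<Rightarrow> real) \<Rightarrow> (real \<Rightarrow> real^3 \<Rightarrow> real^3) \<Rightarrow>
     (real \<Rightarrow> real^3 \<Rightarrow> real^3) \<Rightarrow> (real \<Rightarrow> real^3 \<Rightarrow> real^3^3) \<Rightarrow> bool" where
  "viscous_relations \<mu> lam \<rho> ds u T \<longleftrightarrow>
   (let muT = (\<lambda>t x. sqrt (\<mu> (\<rho> t x)) *\<^sub>R T t x);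
        mu_u = (\<lambda>t x. (\<mu> (\<rho> t x) / sqrt (\<rho> t x)) *\<^sub>R (sqrt (\<rho> t x) *\<^sub>R u t x));
        conv = (\<lambda>t x. outer (sqrt (\<rho> t x) *\<^sub>R u t x) (sqrt (\<rho> t x) *\<^sub>R ds t x));
        ratio = (\<lambda>t x. lam (\<rho> t x) / (2 * \<mu> (\<rho> t x)));
        lam_u = (\<lambda>t x. ratio t x *\<^sub>R mu_u t x);
        trT = (\<lambda>t x. ratio t x * trace (muT t x));
        rem = (\<lambda>t x. ((sqrt (\<rho> t x) *\<^sub>R u t x) \<bullet> (sqrt (\<rho> t x) *\<^sub>R ds t x)) *
                 (\<rho> t x * deriv (deriv \<mu>) (\<rho> t x) / deriv \<mu> (\<rho> t x)))
    in L1loc muT \<and> L1loc mu_u \<and> L1loc conv \<and> L1loc lam_u \<and> L1loc trT \<and> L1loc rem \<and>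
       (\<forall>\<phi>. test_fun \<phi> \<longrightarrow>
          (\<forall>i j. dist_of (\<lambda>t x. muT t x $ i $ j) \<phi> =
             Dx j (dist_of (\<lambda>t x. mu_u t x $ i)) \<phi> - dist_of (\<lambda>t x. conv t x $ i $ j) \<phi>) \<and>
          dist_of trT \<phi> = Div lam_u \<phi> - dist_of rem \<phi>))"

definition sym_part :: "real^3^3 \<Rightarrow> real^3^3" where
  "sym_part T = (1/2) *\<^sub>R (T + transpose T)"

definition stress ::
    "(real \<Rightarrow> real) \<Rightarrow> (real \<Rightarrow> real) \<Rightarrow> (real \<Rightarrow> real^3 \<Rightarrow> real) \<Rightarrow> (real \<Rightarrow> real^3 \<Rightarrow> real^3^3) \<Rightarrow>
     real \<Rightarrow> real^3 \<Rightarrow> real^3^3" where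
  "stress \<mu> lam \<rho> T t x = sqrt (\<mu> (\<rho> t x)) *\<^sub>R sym_part (T t x) +
     (lam (\<rho> t x) / (2 * \<mu> (\<rho> t x)) * trace (sqrt (\<mu> (\<rho> t x)) *\<^sub>R sym_part (T t x))) *\<^sub>R mat 1"


section \<open>Energy inequality\<close>

text \<open>
  \<open>d\<rho>\<close>, \<open>D2Z\<close> and \<open>dZ1\<close> are the (weak) gradient of \<open>\<rho>\<close>, Hessian of \<open>Z(\<rho>)\<close> and gradient of
  \<open>Z1(\<rho>)\<close>.
\<close>

definition energy_inequality ::
    "(real \<Rightarrow> real) \<Rightarrow> real \<Rightarrow> real \<Rightarrow> real \<Rightarrow> real \<Rightarrow> real \<Rightarrow> real \<Rightarrow> real \<Rightarrow>
     (real^3 \<Rightarrow> real) \<Rightarrow> (real^3 \<Rightarrow> real^3) \<Rightarrow> (real^3 \<Rightarrow> real^3) \<Rightarrow>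
     (real \<Rightarrow> real^3 \<Rightarrow> real) \<Rightarrow> (real \<Rightarrow> real^3 \<Rightarrow> real^3) \<Rightarrow> (real \<Rightarrow> real^3 \<Rightarrow> real^3) \<Rightarrow>
     (real \<Rightarrow> real^3 \<Rightarrow> real^3^3) \<Rightarrow> (real \<Rightarrow> real^3 \<Rightarrow> real^3^3) \<Rightarrow> bool" where
  "energy_inequality \<mu> a \<gamma> \<epsilon> r2 \<kappa> \<nu> C0 \<rho>0 w0 v0 \<rho> u v T\<mu> T\<epsilon> \<longleftrightarrow>
   (\<exists>(d\<rho> :: real \<Rightarrow> real^3 \<Rightarrow> real^3) (D2Z :: real \<Rightarrow> real^3 \<Rightarrow> real^3^3)
      (dZ1 :: real \<Rightarrow> real^3 \<Rightarrow> real^3).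
     (AE t in lebesgue_on {0<..}.
        trunc_grad (\<lambda>y. y) (\<rho> t) (d\<rho> t) \<and>
        weak_hess (\<lambda>x. Z_fun \<mu> (\<rho> t x)) (D2Z t) \<and>
        weak_grad (\<lambda>x. Z1_fun \<mu> (\<rho> t x)) (dZ1 t)) \<and>
     integrable torus (energy_density \<mu> a \<gamma> \<epsilon> r2 \<kappa> \<rho>0 w0 v0) \<and>
     (let visc = (\<lambda>(t, x). (norm (T\<mu> t x))\<^sup>2);
          drag = (\<lambda>(t, x). \<rho> t x * (norm (u t x))\<^sup>2);
          cap = (\<lambda>(t, x). (norm (D2Z t x))\<^sup>2 + norm (dZ1 t x) ^ 4 + (norm (T\<epsilon> t x))\<^sup>2);
          pres = (\<lambda>(t, x). deriv \<mu> (\<rho> t x) * deriv (pressure a \<gamma>) (\<rho> t x) / \<rho> t x *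
                    (norm (d\<rho> t x))\<^sup>2)
      in AE t in lebesgue_on {0..}.
           integrable torus (energy_density \<mu> a \<gamma> \<epsilon> r2 \<kappa> (\<rho> t) (w_of \<kappa> u v t) (v t)) \<and>
           integrable (spacetime {0<..<t}) visc \<and> integrable (spacetime {0<..<t}) drag \<and>
           integrable (spacetime {0<..<t}) cap \<and> integrable (spacetime {0<..<t}) pres \<and>
           (\<integral>x. energy_density \<mu> a \<gamma> \<epsilon> r2 \<kappa> (\<rho> t) (w_of \<kappa> u v t) (v t) x \<partial>torus)
           + \<nu> * (\<integral>z. visc z \<partial>spacetime {0<..<t})
           + r2 * (\<integral>z. drag z \<partial>spacetime {0<..<t})
           + \<epsilon> * C0 * (\<integral>z. cap z \<partial>spacetime {0<..<t})
           + 2 * \<kappa> * (\<integral>z. pres z \<partial>spacetime {0<..<t})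
           \<le> (\<integral>x. energy_density \<mu> a \<gamma> \<epsilon> r2 \<kappa> \<rho>0 w0 v0 x \<partial>torus)))"


section \<open>Regularized solutions and their limit\<close>

text \<open>
  One regularized solution.  The vacuum is not excluded: besides the differentiability of the
  density, what is needed is that \<open>Z(\<rho>)\<close> has two continuous derivatives (automatic if \<open>\<rho>\<close> is
  positive and twice continuously differentiable), that the integrals in the dissipation
  inequality exist, and that the entropy can be differentiated in time.
\<close>

definition regularized_solution ::
    "(real \<Rightarrow> real) \<Rightarrow> real \<Rightarrow> real \<Rightarrow> real \<Rightarrow> real \<Rightarrow> real \<Rightarrow> real \<Rightarrow> real \<Rightarrow>
     (real \<Rightarrow> real^3 \<Rightarrow> real) \<Rightarrow> (real \<Rightarrow> real^3 \<Rightarrow> real^3) \<Rightarrow> (real \<Rightarrow> real^3 \<Rightarrow> real^3) \<Rightarrow> bool" where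
  "regularized_solution \<mu> a \<gamma> \<epsilon> r2 \<kappa> C0 r \<rho> u v \<longleftrightarrow>
   (let E = (\<lambda>t. relative_entropy \<mu> a \<gamma> \<epsilon> r2 \<kappa> r (\<rho> t) (w_of \<kappa> u v t) (v t));
        pres = (\<lambda>t x. deriv \<mu> (\<rho> t x) * deriv (deriv (potential (pressure a \<gamma>))) (\<rho> t x) *
                  (norm (grad (\<rho> t) x))\<^sup>2);
        drag = (\<lambda>t x. r2 * \<rho> t x * (norm (u t x))\<^sup>2)
    in (\<forall>t\<ge>0. periodic (\<rho> t) \<and> periodic (u t) \<and> periodic (v t) \<and>
          Ck 1 (\<rho> t) \<and> Ck 2 (\<lambda>x. Z_fun \<mu> (\<rho> t x)) \<and>
          u t \<in> borel_measurable torus \<and>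
          (\<forall>x. 0 \<le> \<rho> t x) \<and> (\<integral>x. \<rho> t x \<partial>torus) = r \<and>
          (\<forall>x. v t x = (if 0 < \<rho> t x then 2 *\<^sub>R grad (\<lambda>y. s_fun \<mu> (\<rho> t y)) x else 0)) \<and>
          E t < \<infinity>) \<and>
       continuous_on {0..} (\<lambda>t. enn2real (E t)) \<and>
       (\<forall>t>0. (\<lambda>t. enn2real (E t)) differentiable (at t) \<and>
          integrable torus (pres t) \<and> integrable torus (drag t) \<and>
          deriv (\<lambda>t. enn2real (E t)) t
          + \<epsilon> * C0 * (\<integral>x. (norm (hess (\<lambda>y. Z_fun \<mu> (\<rho> t y)) x))\<^sup>2 \<partial>torus)
          + \<kappa> * (\<integral>x. pres t x \<partial>torus) + (\<integral>x. drag t x \<partial>torus) \<le> 0))"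

text \<open>
  \<open>(\<rho>, u, v)\<close> is obtained from regularized solutions along a sequence of parameters tending to 0:
  convergence of \<open>\<rho>\<close>, \<open>\<rho> w\<close>, \<open>\<rho> v\<close> in the sense of distributions, strong convergence of the
  initial data together with their entropies, lower semicontinuity of the entropy.
\<close>

definition limit_of_regularized ::
    "(real \<Rightarrow> real) \<Rightarrow> real \<Rightarrow> real \<Rightarrow> real \<Rightarrow> real \<Rightarrow> real \<Rightarrow> real \<Rightarrow> real \<Rightarrow>
     (real^3 \<Rightarrow> real) \<Rightarrow> (real^3 \<Rightarrow> real^3) \<Rightarrow> (real^3 \<Rightarrow> real^3) \<Rightarrow>
     (real \<Rightarrow> real^3 \<Rightarrow> real) \<Rightarrow> (real \<Rightarrow> real^3 \<Rightarrow> real^3) \<Rightarrow> (real \<Rightarrow> real^3 \<Rightarrow> real^3) \<Rightarrow> bool" where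
  "limit_of_regularized \<mu> a \<gamma> \<epsilon> r2 \<kappa> C0 r \<rho>0 w0 v0 \<rho> u v \<longleftrightarrow>
   (\<exists>(\<zeta> :: nat \<Rightarrow> real) (\<rho>\<zeta> :: real \<Rightarrow> real \<Rightarrow> real^3 \<Rightarrow> real)
      (u\<zeta> :: real \<Rightarrow> real \<Rightarrow> real^3 \<Rightarrow> real^3) (v\<zeta> :: real \<Rightarrow> real \<Rightarrow> real^3 \<Rightarrow> real^3).
     let w = w_of \<kappa> u v;
         \<rho>n = (\<lambda>n. \<rho>\<zeta> (\<zeta> n));
         vn = (\<lambda>n. v\<zeta> (\<zeta> n));
         wn = (\<lambda>n. w_of \<kappa> (u\<zeta> (\<zeta> n)) (v\<zeta> (\<zeta> n)));
         E = (\<lambda>t. relative_entropy \<mu> a \<gamma> \<epsilon> r2 \<kappa> r (\<rho> t) (w t) (v t));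
         En = (\<lambda>n t. relative_entropy \<mu> a \<gamma> \<epsilon> r2 \<kappa> r (\<rho>n n t) (wn n t) (vn n t))
     in (\<forall>n. 0 < \<zeta> n) \<and> \<zeta> \<longlonglongrightarrow> 0 \<and>
        (\<forall>n. regularized_solution \<mu> a \<gamma> \<epsilon> r2 \<kappa> C0 r (\<rho>\<zeta> (\<zeta> n)) (u\<zeta> (\<zeta> n)) (v\<zeta> (\<zeta> n))) \<and>
        converges_in_D \<rho>n \<rho> \<and>
        converges_in_D (\<lambda>n t x. \<rho>n n t x *\<^sub>R wn n t x) (\<lambda>t x. \<rho> t x *\<^sub>R w t x) \<and>
        converges_in_D (\<lambda>n t x. \<rho>n n t x *\<^sub>R vn n t x) (\<lambda>t x. \<rho> t x *\<^sub>R v t x) \<and>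
        (\<lambda>n. \<integral>\<^sup>+x. ennreal \<bar>\<rho>n n 0 x - \<rho>0 x\<bar> \<partial>torus) \<longlonglongrightarrow> 0 \<and>
        (\<lambda>n. \<integral>\<^sup>+x. ennreal ((norm (sqrt (\<rho>n n 0 x) *\<^sub>R wn n 0 x - sqrt (\<rho>0 x) *\<^sub>R w0 x))\<^sup>2) \<partial>torus)
          \<longlonglongrightarrow> 0 \<and>
        (\<lambda>n. \<integral>\<^sup>+x. ennreal ((norm (sqrt (\<rho>n n 0 x) *\<^sub>R vn n 0 x - sqrt (\<rho>0 x) *\<^sub>R v0 x))\<^sup>2) \<partial>torus)
          \<longlonglongrightarrow> 0 \<and>
        (\<lambda>n. En n 0) \<longlonglongrightarrow> E 0 \<and>
        (\<forall>t>0. E t \<le> liminf (\<lambda>n. En n t)))"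


section \<open>Global weak solutions\<close>

text \<open>
  The fields are jointly measurable and, the entropy being considered at every time, \<open>v = 2 \<nabla>s(\<rho>)\<close>
  holds at every time.  \<open>Z(\<rho>)\<close> is required to be in \<open>L^q(0,T; L^1)\<close> for some \<open>q > 1\<close> and all
  finite \<open>T\<close>: on the whole half-line this would exclude every solution with \<open>\<rho>\<close> converging to a
  constant other than 1, the zero of \<open>Z\<close>.
\<close>

definition global_weak_solution ::
    "(real \<Rightarrow> real) \<Rightarrow> (real \<Rightarrow> real) \<Rightarrow> real \<Rightarrow> real \<Rightarrow> real \<Rightarrow> real \<Rightarrow> real \<Rightarrow> real \<Rightarrow> real \<Rightarrow>
     (real^3 \<Rightarrow> real) \<Rightarrow> (real^3 \<Rightarrow> real^3) \<Rightarrow> (real^3 \<Rightarrow> real^3) \<Rightarrow> (real^3 \<Rightarrow> real^3) \<Rightarrow>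
     (real \<Rightarrow> real^3 \<Rightarrow> real) \<Rightarrow> (real \<Rightarrow> real^3 \<Rightarrow> real^3) \<Rightarrow> (real \<Rightarrow> real^3 \<Rightarrow> real^3) \<Rightarrow> bool" where
  "global_weak_solution \<mu> lam a \<gamma> \<epsilon> r2 \<nu> \<kappa> r \<rho>0 m0 w0 v0 \<rho> u v \<longleftrightarrow>
   0 < \<kappa> \<and> \<kappa> < 1 \<and>
   case_prod \<rho> \<in> borel_measurable (spacetime {0<..}) \<and>
   case_prod u \<in> borel_measurable (spacetime {0<..}) \<and>
   case_prod v \<in> borel_measurable (spacetime {0<..}) \<and>
   (\<forall>t\<ge>0. periodic (\<rho> t) \<and> periodic (u t) \<and> periodic (v t) \<and>
      \<rho> t \<in> borel_measurable torus \<and> u t \<in> borel_measurable torus \<and> v t \<in> borel_measurable torus \<and>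
      trunc_grad (s_fun \<mu>) (\<rho> t) (\<lambda>x. (1/2) *\<^sub>R v t x)) \<and>
   (AE x in torus. w_of \<kappa> u v 0 x = w0 x) \<and> (AE x in torus. v 0 x = v0 x) \<and>

   C0_Lq_weak \<gamma> \<rho> \<and> (\<forall>t>0. AE x in torus. 0 \<le> \<rho> t x) \<and> (AE x in torus. \<rho> 0 x = \<rho>0 x) \<and>
   C0_Lq_weak (3/2) (\<lambda>t x. \<mu> (\<rho> t x)) \<and>

   C0_Lq_weak (2 * \<gamma> / (\<gamma> + 1)) (\<lambda>t x. \<rho> t x *\<^sub>R u t x) \<and>
   (AE x in torus. \<rho> 0 x *\<^sub>R u 0 x = m0 x) \<and>

   in_Linf_W11 (\<lambda>t x. \<mu> (\<rho> t x)) \<and>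
   in_Linf_Lq (3/2) (\<lambda>t x. \<mu> (\<rho> t x) *\<^sub>R u t x) \<and>
   in_L2_W11 (\<lambda>t x. \<mu> (\<rho> t x) *\<^sub>R u t x) \<and>
   in_Linf_Wm11 (Dt (dist_of (\<lambda>t x. \<mu> (\<rho> t x)))) \<and>
   (\<exists>q>1. \<forall>T>0. in_Lp_L1 {0<..<T} q (\<lambda>t x. Z_fun \<mu> (\<rho> t x))) \<and>

   L1loc \<rho> \<and> L1loc (\<lambda>t x. \<rho> t x *\<^sub>R u t x) \<and>
   (\<forall>\<phi>. test_fun \<phi> \<longrightarrow> Dt (dist_of \<rho>) \<phi> + Div (\<lambda>t x. \<rho> t x *\<^sub>R u t x) \<phi> = 0) \<and>

   (\<exists>C0>0. \<exists>T\<mu> T\<epsilon>.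
      case_prod T\<mu> \<in> borel_measurable (spacetime {0<..}) \<and>
      case_prod T\<epsilon> \<in> borel_measurable (spacetime {0<..}) \<and>
      viscous_relations \<mu> lam \<rho> (\<lambda>t x. (1/2) *\<^sub>R v t x) u T\<mu> \<and>
      viscous_relations \<mu> lam \<rho> (\<lambda>t x. (1/2) *\<^sub>R v t x) v T\<epsilon> \<and>

      energy_inequality \<mu> a \<gamma> \<epsilon> r2 \<kappa> \<nu> C0 \<rho>0 w0 v0 \<rho> u v T\<mu> T\<epsilon> \<and>

      L1loc (\<lambda>t x. \<rho> t x *\<^sub>R outer (u t x) (u t x)) \<and>
      L1loc (\<lambda>t x. pressure a \<gamma> (\<rho> t x)) \<and>
      L1loc (stress \<mu> lam \<rho> T\<mu>) \<and> L1loc (stress \<mu> lam \<rho> T\<epsilon>) \<and>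
      (\<forall>\<phi> i. test_fun \<phi> \<longrightarrow>
         Dt (dist_of (\<lambda>t x. \<rho> t x * u t x $ i)) \<phi>
         + Div (\<lambda>t x. (\<rho> t x *\<^sub>R outer (u t x) (u t x)) $ i) \<phi>
         + Dx i (dist_of (\<lambda>t x. pressure a \<gamma> (\<rho> t x))) \<phi>
         + r2 * dist_of (\<lambda>t x. \<rho> t x * u t x $ i) \<phi>
         - 2 * Div (\<lambda>t x. stress \<mu> lam \<rho> T\<mu> t x $ i) \<phi>
         - 2 * \<epsilon> * Div (\<lambda>t x. stress \<mu> lam \<rho> T\<epsilon> t x $ i) \<phi> = 0) \<and>

      (\<forall>\<phi>. test_fun \<phi> \<longrightarrow>
         Dt (dist_of (\<lambda>t x. \<mu> (\<rho> t x))) \<phi> + Div (\<lambda>t x. \<mu> (\<rho> t x) *\<^sub>R u t x) \<phi>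
         + dist_of (\<lambda>t x. lam (\<rho> t x) / (2 * \<mu> (\<rho> t x)) *
                      trace (sqrt (\<mu> (\<rho> t x)) *\<^sub>R T\<mu> t x)) \<phi> = 0) \<and>

      limit_of_regularized \<mu> a \<gamma> \<epsilon> r2 \<kappa> C0 r \<rho>0 w0 v0 \<rho> u v)"

end

theory Submission
  imports Defs
begin

text \<open>
  The entropy of a regularized solution is nonincreasing, hence bounded by some \<open>M\<close> uniformly in time and
  in the regularization, so it suffices to bound it by the dissipation \<open>D\<close> when \<open>D\<close> is small:
  for \<open>D \<ge> d\<close> one has \<open>E \<le> (M / d) D\<close>.  If \<open>D\<close> is small, then so is the \<open>L\<^sup>2\<close> norm of the
  Hessian of \<open>Z(\<rho>)\<close>, and since \<open>H\<^sup>2\<close> embeds into \<open>L\<^sup>\<infinity>\<close> in dimension three, \<open>Z(\<rho>)\<close> is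
  uniformly close to \<open>Z(r)\<close>.  Then \<open>\<rho>\<close> takes values in \<open>[r/2, 2 r]\<close>, where all the constitutive
  functions are comparable: the potential parts of \<open>E\<close> are bounded by \<open>(Z(\<rho>) - Z(r))\<^sup>2\<close>, the
  \<open>v\<close> part by \<open>|\<nabla>Z(\<rho>)|\<^sup>2\<close>, and the rest of the \<open>w\<close> part by the drag.  Gronwall's lemma gives the
  decay of the regularized entropies, and lower semicontinuity passes to the limit.
\<close>

section \<open>Calculus on the unit cell\<close>

text \<open>\<open>One\<close> abbreviates the sum of the basis vectors, so this simp rule evaluates
  the coordinates of the upper corner of the cell.\<close>

lemma sum_Basis_nth [simp]: "(\<Sum>b\<in>(Basis::(real^3) set). b $ i) = 1"
proof -
  have "(One::real^3) \<bullet> axis i 1 = 1"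
    by (rule inner_sum_Basis) (simp add: axis_in_Basis_iff)
  then show ?thesis by (simp add: inner_axis)
qed

lemma mem_cell: "x \<in> cell \<longleftrightarrow> (\<forall>i. 0 \<le> x $ i \<and> x $ i \<le> 1)"
  by (simp add: cell_def mem_box_cart)

lemma integral_cell_const [simp]: "integral cell (\<lambda>x. c) = (c::real)"
  by (simp add: cell_def content_unit)

lemma integrable_on_cell:
  fixes h :: "real^3 \<Rightarrow> real"
  shows "continuous_on cell h \<Longrightarrow> h integrable_on cell"
  unfolding cell_def by (rule integrable_continuous)

text \<open>The notions are stated with the Bochner integral over \<open>torus\<close>, while change
  of variables, splitting and differentiation under the integral are done with the Henstock-Kurzweil
  integral over \<open>cell\<close>; this is the bridge.\<close>

lemma integral_torus_continuous:
  fixes h :: "real^3 \<Rightarrow> real"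
  assumes "continuous_on cell h"
  shows "integrable torus h" "integral\<^sup>L torus h = integral cell h"
proof -
  show "integrable torus h"
    using assms continuous_imp_integrable unfolding torus_def cell_def by blast
  then show "integral\<^sup>L torus h = integral cell h"
    unfolding torus_def by (intro lebesgue_integral_eq_integral) (auto simp: cell_def)
qed

section \<open>Classical derivatives of functions of class C^k\<close>

lemma Ck_1_derivative:
  assumes "Ck 1 f"
  shows "(f has_derivative (\<lambda>d. grad f x \<bullet> d)) (at x)"
proof -
  let ?D = "frechet_derivative f (at x)"
  have D: "(f has_derivative ?D) (at x)"
    using assms by (simp add: frechet_derivative_works)
  then have lin: "linear ?D"
    using has_derivative_linear by blast
  have "?D d = grad f x \<bullet> d" for d
  proof -
    have "?D d = ?D (\<Sum>i\<in>UNIV. d $ i *\<^sub>R axis i 1)"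
      by (simp flip: scalar_mult_eq_scaleR add: basis_expansion)
    also have "\<dots> = (\<Sum>i\<in>UNIV. d $ i * pd i f x)"
      by (simp add: linear_sum[OF lin] linear_scale[OF lin] pd_def)
    finally show ?thesis by (simp add: inner_vec_def grad_def mult.commute)
  qed
  then show ?thesis using D by (metis (no_types, lifting) ext)
qed

lemma Ck_1_continuous: "Ck 1 f \<Longrightarrow> continuous_on A f"
  by (simp add: differentiable_imp_continuous_on differentiable_on_def differentiable_at_withinI)

lemma continuous_on_pd: "Ck 1 f \<Longrightarrow> continuous_on A (pd i f)"
  unfolding pd_def by (auto intro: continuous_on_subset)

lemma Ck_2_D: "Ck 2 f \<Longrightarrow> Ck 1 f" "Ck 2 f \<Longrightarrow> Ck 1 (pd i f)"
proof -
  assume f: "Ck 2 f"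
  then have D: "\<forall>x. f differentiable (at x)" "\<forall>d. Ck 1 (\<lambda>x. frechet_derivative f (at x) d)"
    by (auto simp: numeral_2_eq_2)
  then show "Ck 1 (pd i f)" by (simp add: pd_def[abs_def])
  \<comment> \<open>\<open>Ck\<close> descends one order here because a directional derivative that
    is itself differentiable is continuous.\<close>
  have "Ck 0 (\<lambda>x. frechet_derivative f (at x) d)" for d
    using D Ck_1_continuous[of "\<lambda>x. frechet_derivative f (at x) d" UNIV] by simp
  then show "Ck 1 f" using D by simp
qed

lemma continuous_on_grad: "Ck 1 f \<Longrightarrow> continuous_on A (grad f)"
  unfolding grad_def by (intro continuous_on_vec_lambda continuous_on_pd)

lemma continuous_on_hess: "Ck 2 f \<Longrightarrow> continuous_on A (hess f)"
  unfolding hess_def by (intro continuous_on_vec_lambda continuous_on_pd Ck_2_D)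

lemma has_real_derivative_along_line:
  assumes "Ck 1 f"
  shows "((\<lambda>s. f (x + s *\<^sub>R d)) has_real_derivative grad f (x + s *\<^sub>R d) \<bullet> d) (at s within A)"
proof -
  have "((\<lambda>s. f (x + s *\<^sub>R d)) has_derivative (\<lambda>h. grad f (x + s *\<^sub>R d) \<bullet> (h *\<^sub>R d))) (at s within A)"
    by (rule has_derivative_compose[OF _ Ck_1_derivative[OF assms], where f="\<lambda>s. x + s *\<^sub>R d"])
       (auto intro!: derivative_eq_intros)
  then show ?thesis
    by (simp add: has_field_derivative_def mult.commute[of _ "grad _ _ \<bullet> _"])
qed

section \<open>Jensen and contraction estimates on the cell\<close>

text \<open>The variance of \<open>g\<close> is nonnegative, and the cell has volume one.\<close>

lemma integral_cell_square_le:
  fixes g :: "real^3 \<Rightarrow> real"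
  assumes "continuous_on cell g"
  shows "(integral cell g)\<^sup>2 \<le> integral cell (\<lambda>x. (g x)\<^sup>2)"
proof -
  define m where "m = integral cell g"
  have "0 \<le> integral cell (\<lambda>x. (g x - m)\<^sup>2)"
    by (intro integral_nonneg integrable_on_cell continuous_intros assms) auto
  also have "\<dots> = integral cell (\<lambda>x. (g x)\<^sup>2 - (2 * m * g x - m\<^sup>2))"
    by (simp add: power2_eq_square algebra_simps)
  also have "\<dots> = integral cell (\<lambda>x. (g x)\<^sup>2) - (integral cell (\<lambda>x. 2 * m * g x) - m\<^sup>2)"
    by (subst Henstock_Kurzweil_Integration.integral_diff,
        intro integrable_on_cell continuous_intros assms,
        intro integrable_on_cell continuous_intros assms,
        subst Henstock_Kurzweil_Integration.integral_diff,
        (intro integrable_on_cell continuous_intros assms)+) simp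
  also have "\<dots> = integral cell (\<lambda>x. (g x)\<^sup>2) - m\<^sup>2"
    by (simp add: m_def power2_eq_square)
  finally show ?thesis by (simp add: m_def)
qed

lemma integral_cell_le_sqrt:
  fixes g :: "real^3 \<Rightarrow> 'b::real_normed_vector"
  assumes "continuous_on cell g"
  shows "integral cell (\<lambda>x. norm (g x)) \<le> sqrt (integral cell (\<lambda>x. (norm (g x))\<^sup>2))"
  by (intro real_le_rsqrt integral_cell_square_le continuous_intros assms)

text \<open>The contraction towards \<open>x\<close> maps the convex cell onto a subcube of side
  \<open>s\<close>; the change of variables costs s^(-3), and enlarging the subcube to the cell only
  increases the integral of a nonnegative function.\<close>

lemma integral_cell_contract_le:
  fixes g :: "real^3 \<Rightarrow> real"
  assumes g: "continuous_on cell g" "\<And>x. 0 \<le> g x" and x: "x \<in> cell" and s: "0 < s" "s \<le> 1"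
  shows "integral cell (\<lambda>y. g (x + s *\<^sub>R (y - x))) \<le> integral cell g / s ^ 3"
proof -
  \<comment> \<open>With this \<open>c\<close> the contraction takes the affine form
    \<open>s *\<^sub>R y + c\<close>, and \<open>B\<close> is the image of the cell.\<close>
  define c where "c = x - s *\<^sub>R x"
  define B where "B = cbox c (s *\<^sub>R One + c)"
  have sub: "B \<subseteq> cell"
  proof
    fix z assume "z \<in> B"
    then have z: "c $ i \<le> z $ i" "z $ i \<le> s + c $ i" for i
      by (auto simp: B_def mem_box_cart)
    show "z \<in> cell" unfolding mem_cell
    proof
      fix i
      have xi: "0 \<le> x $ i" "x $ i \<le> 1" using x by (auto simp: mem_cell)
      have "c $ i = (1 - s) * x $ i" by (simp add: c_def algebra_simps)
      moreover have "0 \<le> (1 - s) * x $ i" "(1 - s) * x $ i \<le> 1 - s"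
        using xi s by (auto intro: mult_left_le)
      ultimately show "0 \<le> z $ i \<and> z $ i \<le> 1" using z[of i] by linarith
    qed
  qed
  have gB: "g integrable_on B"
    unfolding B_def by (rule integrable_continuous, rule continuous_on_subset[OF g(1)])
      (use sub in \<open>simp add: B_def\<close>)
  have "((\<lambda>y. g (s *\<^sub>R y + c)) has_integral (integral B g /\<^sub>R s ^ DIM(real^3)))
      (cbox ((c - c) /\<^sub>R s) ((s *\<^sub>R One + c - c) /\<^sub>R s))"
    by (rule has_integral_affinity') (use gB s in \<open>auto simp: B_def\<close>)
  then have "((\<lambda>y. g (s *\<^sub>R y + c)) has_integral (integral B g / s ^ 3)) cell"
    using s by (simp add: cell_def field_simps power3_eq_cube)
  moreover have "s *\<^sub>R y + c = x + s *\<^sub>R (y - x)" for y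
    by (simp add: c_def algebra_simps)
  ultimately have "integral cell (\<lambda>y. g (x + s *\<^sub>R (y - x))) = integral B g / s ^ 3"
    by (simp add: integral_unique)
  also have "\<dots> \<le> integral cell g / s ^ 3"
    using s g(2) by (intro divide_right_mono integral_subset_le sub gB integrable_on_cell g(1)) auto
  finally show ?thesis .
qed

section \<open>Translation invariance and integration by parts for periodic functions\<close>

lemma cbox_inter_halfspaces:
  fixes a b :: "real^3"
  shows "cbox a b \<inter> {x. x \<bullet> axis k 1 \<le> c} = cbox a (\<chi> i. if i = k then min (b $ k) c else b $ i)"
    and "cbox a b \<inter> {x. x \<bullet> axis k 1 \<ge> c} = cbox (\<chi> i. if i = k then max (a $ k) c else a $ i) b"
  by (auto simp: mem_box_cart inner_axis split: if_splits)

text \<open>Cut the cell at height \<open>t\<close> and the translated cell at height 1 in direction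
  \<open>k\<close>. They share one piece, and the two other pieces differ by one period.\<close>

lemma integral_cell_translate:
  fixes h :: "real^3 \<Rightarrow> real"
  assumes cont: "continuous_on UNIV h" and per: "periodic h" and t: "0 \<le> t" "t \<le> 1"
  shows "integral cell (\<lambda>x. h (x + t *\<^sub>R axis k 1)) = integral cell h"
proof -
  let ?e = "axis k 1 :: real^3"
  have int: "h integrable_on cbox a b" for a b
    using cont by (intro integrable_continuous) (rule continuous_on_subset, auto)
  have shift: "integral (cbox a b) (\<lambda>x. h (x + c)) = integral (cbox (a + c) (b + c)) h" for a b c
  proof -
    have "((\<lambda>x. h (1 *\<^sub>R x + c)) has_integral (integral (cbox (a + c) (b + c)) h /\<^sub>R 1 ^ DIM(real^3)))
        (cbox ((a + c - c) /\<^sub>R 1) ((b + c - c) /\<^sub>R 1))"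
      by (rule has_integral_affinity') (use int in auto)
    then show ?thesis by (simp add: integral_unique)
  qed
  \<comment> \<open>\<open>p\<close> is the upper corner of the slab cut off below height
    \<open>t\<close>: its \<open>k\<close>-th coordinate is \<open>t\<close>, the others are 1. The
    facts \<open>p1\<close> to \<open>p4\<close> identify the corners produced by the two
    cuts.\<close>
  define p where "p = (One::real^3) + t *\<^sub>R ?e - ?e"
  have eB: "?e \<in> Basis" by (simp add: axis_in_Basis_iff)
  have p1: "(\<chi> i. if i = k then min ((One::real^3) $ k) t else (One::real^3) $ i) = p"
    using t by (simp add: vec_eq_iff p_def axis_def min_def)
  have p2: "(\<chi> i. if i = k then max ((0::real^3) $ k) t else (0::real^3) $ i) = t *\<^sub>R ?e"
    using t by (simp add: vec_eq_iff axis_def max_def)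
  have p3: "(\<chi> i. if i = k then min ((One + t *\<^sub>R ?e) $ k) 1 else (One + t *\<^sub>R ?e) $ i) = One"
    using t by (simp add: vec_eq_iff axis_def min_def)
  have p4: "(\<chi> i. if i = k then max ((t *\<^sub>R ?e) $ k) 1 else (t *\<^sub>R ?e) $ i) = ?e"
    using t by (simp add: vec_eq_iff axis_def max_def)
  have "integral cell h = integral (cbox 0 p) h + integral (cbox (t *\<^sub>R ?e) One) h"
    unfolding cell_def integral_split[OF int eB, of 0 One t] cbox_inter_halfspaces p1 p2 ..
  moreover have "integral cell (\<lambda>x. h (x + t *\<^sub>R ?e)) = integral (cbox (t *\<^sub>R ?e) (One + t *\<^sub>R ?e)) h"
    unfolding cell_def shift by simp
  moreover have "\<dots> = integral (cbox (t *\<^sub>R ?e) One) h + integral (cbox ?e (One + t *\<^sub>R ?e)) h"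
    unfolding integral_split[OF int eB, of "t *\<^sub>R ?e" "One + t *\<^sub>R ?e" 1] cbox_inter_halfspaces p3 p4 ..
  moreover have "integral (cbox ?e (One + t *\<^sub>R ?e)) h = integral (cbox 0 p) (\<lambda>x. h (x + ?e))"
    by (simp add: shift p_def)
  moreover have "\<dots> = integral (cbox 0 p) h"
    using per by (simp add: periodic_def)
  ultimately show ?thesis by simp
qed

text \<open>The integral of the translates of \<open>h\<close> is constant in the translation, and
  its derivative at 0, taken under the integral sign, is the integral of \<open>h'\<close>. The
  derivative is one-sided because invariance was shown for translations in [0,1].\<close>

lemma integral_cell_directional_derivative:
  fixes h h' :: "real^3 \<Rightarrow> real"
  assumes der: "\<And>x s. ((\<lambda>s. h (x + s *\<^sub>R axis k 1)) has_real_derivative h' (x + s *\<^sub>R axis k 1)) (at s)"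
    and cont: "continuous_on UNIV h" "continuous_on UNIV h'" and per: "periodic h"
  shows "integral cell h' = 0"
proof -
  define P where "P s = integral cell (\<lambda>x. h (x + s *\<^sub>R axis k 1))" for s
  have 1: "(P has_real_derivative integral cell (\<lambda>x. h' (x + 0 *\<^sub>R axis k 1))) (at 0 within {0..1})"
    unfolding P_def cell_def
    by (rule leibniz_rule_field_derivative)
       (auto simp: split_def intro!: has_field_derivative_at_within[OF der] integrable_continuous
          continuous_intros continuous_on_compose2[OF cont(1)] continuous_on_compose2[OF cont(2)])
  have "P s = integral cell h" if "s \<in> {0..1}" for s
    using that integral_cell_translate[OF cont(1) per] by (simp add: P_def)
  then have 2: "(P has_real_derivative 0) (at 0 within {0..1})"
    by (intro has_field_derivative_transform_within[OF DERIV_const, of 1]) auto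
  have "at (0::real) within {0..1} \<noteq> bot"
    by (simp add: at_within_Icc_at_right)
  from has_field_derivative_unique[OF 1 2 this] show ?thesis by simp
qed

section \<open>A Sobolev inequality on the torus\<close>

definition hess_energy :: "(real^3 \<Rightarrow> real) \<Rightarrow> real" where
  "hess_energy f = integral cell (\<lambda>x. (norm (hess f x))\<^sup>2)"

lemma hess_energy_nonneg: "Ck 2 f \<Longrightarrow> 0 \<le> hess_energy f"
  unfolding hess_energy_def
  by (intro integral_nonneg integrable_on_cell continuous_intros continuous_on_hess) auto

lemma norm_matrix_vector_le:
  fixes A :: "real^3^3"
  shows "norm (A *v d) \<le> 3 * norm A * norm d"
proof -
  have "norm (A *v d) \<le> (\<Sum>i\<in>UNIV. \<bar>(A *v d) $ i\<bar>)"
    by (rule norm_le_l1_cart)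
  also have "\<dots> \<le> (\<Sum>i\<in>(UNIV::3 set). norm A * norm d)"
  proof (rule sum_mono)
    fix i
    have "\<bar>(A *v d) $ i\<bar> \<le> norm (A $ i) * norm d"
      by (simp add: matrix_vector_mul_component Cauchy_Schwarz_ineq2)
    also have "\<dots> \<le> norm A * norm d"
      by (intro mult_right_mono Finite_Cartesian_Product.norm_nth_le) auto
    finally show "\<bar>(A *v d) $ i\<bar> \<le> norm A * norm d" .
  qed
  finally show ?thesis by simp
qed

lemma norm_diff_cell:
  assumes "x \<in> cell" "y \<in> cell"
  shows "(norm (y - x))\<^sup>2 \<le> 3"
proof -
  have "((y - x) $ i)\<^sup>2 \<le> 1" for i
  proof -
    have "0 \<le> x $ i" "x $ i \<le> 1" "0 \<le> y $ i" "y $ i \<le> 1" using assms by (auto simp: mem_cell)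
    then have "\<bar>(y - x) $ i\<bar> \<le> 1" by auto
    then show ?thesis by (simp add: abs_square_le_1)
  qed
  then have "(\<Sum>i\<in>(UNIV::3 set). ((y - x) $ i)\<^sup>2) \<le> (\<Sum>i\<in>(UNIV::3 set). 1)"
    by (intro sum_mono) 
  then show ?thesis
    unfolding power2_norm_eq_inner by (simp add: inner_vec_def power2_eq_square)
qed

lemma has_real_derivative_along_line_2:
  assumes f: "Ck 2 f"
  shows "((\<lambda>s. grad f (x + s *\<^sub>R d) \<bullet> d) has_real_derivative
           d \<bullet> (hess f (x + s *\<^sub>R d) *v d)) (at s within A)"
proof -
  have "((\<lambda>s. \<Sum>i\<in>UNIV. pd i f (x + s *\<^sub>R d) * d $ i) has_real_derivative
      (\<Sum>i\<in>UNIV. (grad (pd i f) (x + s *\<^sub>R d) \<bullet> d) * d $ i)) (at s within A)"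
    by (intro DERIV_sum DERIV_cmult_right has_real_derivative_along_line Ck_2_D f)
  moreover have "(hess f z *v d) $ i = grad (pd i f) z \<bullet> d" for z i
    by (simp add: matrix_vector_mult_def inner_vec_def hess_def grad_def)
  ultimately show ?thesis
    by (simp add: inner_vec_def grad_def mult.commute)
qed

text \<open>Taylor's formula \<open>g 0 = g 1 - g' 1 + \<integral> s g'' s ds\<close> on the segments from \<open>x\<close> to the points of the cell,
  averaged over the cell.  Contracting the cell by \<open>s\<close> turns \<open>L^1\<close> norms of the Hessian into at most
  \<open>s^(-3/2)\<close> times its \<open>L^2\<close> norm, and \<open>s * s^(-3/2)\<close> is integrable at 0.\<close>

lemma cell_taylor:
  assumes f: "Ck 2 f" and x: "x \<in> cell"
  shows "\<bar>integral cell (\<lambda>y. f y - grad f y \<bullet> (y - x)) - f x\<bar> \<le> 18 * sqrt (hess_energy f)"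
proof -
  define N where "N = sqrt (hess_energy f)"
  define z where "z s y = x + s *\<^sub>R (y - x)" for s y
  \<comment> \<open>\<open>g s y\<close> is the linearization of \<open>f\<close> at
    \<open>z s y\<close>, evaluated at \<open>x\<close>. In its \<open>s\<close>-derivative the
    first-order terms cancel and only \<open>- s * Q s y\<close> remains; its average
    \<open>G\<close> runs from \<open>f x\<close> at 0 to the averaged expression at 1.\<close>
  define g where "g s y = f (z s y) - s * (grad f (z s y) \<bullet> (y - x))" for s y
  define Q where "Q s y = (y - x) \<bullet> (hess f (z s y) *v (y - x))" for s y
  define G where "G s = integral cell (g s)" for s
  note cf = continuous_on_compose2[OF Ck_1_continuous[OF Ck_2_D(1)[OF f], of UNIV]]
    continuous_on_compose2[OF continuous_on_grad[OF Ck_2_D(1)[OF f], of UNIV]]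
    continuous_on_compose2[OF continuous_on_hess[OF f, of UNIV]]
  have cmv: "continuous_on A (\<lambda>p. F p *v D p)"
    if "continuous_on A F" "continuous_on A D" for A and F :: "'a::topological_space \<Rightarrow> real^3^3" and D
    unfolding matrix_vector_mult_def using that
    by (intro continuous_on_vec_lambda continuous_intros) auto
  have contQ: "continuous_on A (Q s)" for A s
    unfolding Q_def z_def by (intro continuous_intros cmv cf) auto
  have der_g: "((\<lambda>s. g s y) has_real_derivative - (s * Q s y)) (at s)" for s y
    unfolding g_def z_def Q_def
    by (rule derivative_eq_intros has_real_derivative_along_line has_real_derivative_along_line_2
        Ck_2_D f refl)+ simp
  have der_G: "(G has_real_derivative integral cell (\<lambda>y. - (s * Q s y))) (at s)" for s
    unfolding G_def cell_def
  proof (rule leibniz_rule_field_derivative[where U=UNIV])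
    show "g s integrable_on cbox 0 One" for s
      unfolding g_def z_def by (intro integrable_continuous continuous_intros cf) auto
    show "continuous_on (UNIV \<times> cbox 0 One) (\<lambda>(s, y). - (s * Q s y))"
      unfolding Q_def z_def split_def by (intro continuous_intros cmv cf) auto
  qed (use der_g in auto)
  \<comment> \<open>9 is the factor 3 of the matrix bound times the bound 3 for the squared diameter
    of the cell.\<close>
  have Q_le: "\<bar>Q s y\<bar> \<le> 9 * norm (hess f (z s y))" if "y \<in> cell" for s y
  proof -
    have "\<bar>Q s y\<bar> \<le> norm (y - x) * norm (hess f (z s y) *v (y - x))"
      unfolding Q_def by (rule Cauchy_Schwarz_ineq2)
    also have "\<dots> \<le> norm (y - x) * (3 * norm (hess f (z s y)) * norm (y - x))"
      by (intro mult_left_mono norm_matrix_vector_le) auto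
    also have "\<dots> = 3 * norm (hess f (z s y)) * (norm (y - x))\<^sup>2"
      by (simp add: power2_eq_square)
    also have "\<dots> \<le> 3 * norm (hess f (z s y)) * 3"
      by (intro mult_left_mono norm_diff_cell x that) auto
    finally show ?thesis by simp
  qed
  \<comment> \<open>Jensen and contraction give 9 s * sqrt (s^(-3)) N = 9 N / sqrt s, an integrable
    singularity.\<close>
  have N_le: "\<bar>integral cell (\<lambda>y. - (s * Q s y))\<bar> \<le> 9 * N / sqrt s" if s: "0 < s" "s \<le> 1" for s
  proof -
    have ch: "continuous_on A (\<lambda>y. hess f (z s y))" for A
      unfolding z_def by (intro continuous_intros cf) auto
    have "\<bar>integral cell (\<lambda>y. - (s * Q s y))\<bar> \<le> integral cell (\<lambda>y. 9 * s * norm (hess f (z s y)))"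
      unfolding real_norm_def[symmetric]
    proof (rule integral_norm_bound_integral)
      show "(\<lambda>y. - (s * Q s y)) integrable_on cell" "(\<lambda>y. 9 * s * norm (hess f (z s y))) integrable_on cell"
        by (intro integrable_on_cell continuous_intros contQ ch)+
      show "norm (- (s * Q s y)) \<le> 9 * s * norm (hess f (z s y))" if "y \<in> cell" for y
        using mult_left_mono[OF Q_le[OF that, of s], of s] s by (simp add: abs_mult)
    qed
    also have "\<dots> = 9 * s * integral cell (\<lambda>y. norm (hess f (z s y)))"
      by simp
    also have "\<dots> \<le> 9 * s * sqrt (integral cell (\<lambda>y. (norm (hess f (z s y)))\<^sup>2))"
      using s by (intro mult_left_mono integral_cell_le_sqrt ch) auto
    also have "\<dots> \<le> 9 * s * sqrt (hess_energy f / s ^ 3)"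
      using s x unfolding hess_energy_def z_def
      by (intro mult_left_mono real_sqrt_le_mono
          integral_cell_contract_le[where g="\<lambda>x. (norm (hess f x))\<^sup>2"] continuous_intros continuous_on_hess f) auto
    also have "\<dots> = 9 * N / sqrt s"
    proof -
      have "sqrt (s ^ 3) = s * sqrt s"
        using s by (simp add: power3_eq_cube real_sqrt_mult)
      then show ?thesis using s by (simp add: N_def real_sqrt_divide field_simps)
    qed
    finally show ?thesis .
  qed
  \<comment> \<open>\<open>18 * N * sqrt s\<close> is a primitive of the bound
    \<open>9 * N / sqrt s\<close> for the derivative of \<open>G\<close>, so adding it to
    \<open>G\<close> or to \<open>- G\<close> gives a nondecreasing function. The comparison
    differentiates only inside (0,1), away from the singularity; the two signs give \<bar>G 1 - G
    0\<bar> \<le> 18 N.\<close>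
  have mono: "18 * N * sqrt 0 + \<sigma> * G 0 \<le> 18 * N * sqrt 1 + \<sigma> * G 1" if "\<bar>\<sigma>\<bar> = 1" for \<sigma>
  proof (rule DERIV_nonneg_imp_increasing_open[where f="\<lambda>s. 18 * N * sqrt s + \<sigma> * G s"])
    fix s :: real assume s: "0 < s" "s < 1"
    let ?I = "integral cell (\<lambda>y. - (s * Q s y))"
    have "((\<lambda>s. 18 * N * sqrt s + \<sigma> * G s) has_real_derivative 9 * N / sqrt s + \<sigma> * ?I) (at s)"
      using s by (auto intro!: derivative_eq_intros der_G simp: field_simps)
    moreover have "\<bar>\<sigma> * ?I\<bar> \<le> 9 * N / sqrt s"
      using N_le s that by (simp add: abs_mult)
    ultimately show "\<exists>y. ((\<lambda>s. 18 * N * sqrt s + \<sigma> * G s) has_real_derivative y) (at s) \<and> 0 \<le> y"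
      by (intro exI[of _ "9 * N / sqrt s + \<sigma> * ?I"]) linarith
  next
    show "continuous_on {0..1} (\<lambda>s. 18 * N * sqrt s + \<sigma> * G s)"
      by (intro continuous_intros continuous_at_imp_continuous_on ballI DERIV_isCont[OF der_G])
  qed simp
  have "G 0 = f x" 
    by (simp add: G_def g_def[abs_def] z_def)
  moreover have "G 1 = integral cell (\<lambda>y. f y - grad f y \<bullet> (y - x))"
    by (simp add: G_def g_def[abs_def] z_def)
  ultimately show ?thesis
    using mono[of 1] mono[of "-1"] by (simp add: N_def abs_le_iff)
qed

text \<open>A partial derivative is the ordinary derivative along an axis, and the restrictions of
  \<open>f\<close> to a line and to its translate by a period agree.\<close>

lemma periodic_pd:
  assumes f: "Ck 1 f" and per: "periodic f"
  shows "periodic (pd i f)"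
  unfolding periodic_def
proof (intro allI)
  fix x k
  have D: "((\<lambda>s. f (y + s *\<^sub>R axis i 1)) has_real_derivative pd i f y) (at 0)" for y
    using has_real_derivative_along_line[OF f, of y "axis i 1" 0]
    by (simp add: inner_axis grad_def)
  have "f (x + axis k 1 + s *\<^sub>R axis i 1) = f (x + s *\<^sub>R axis i 1)" for s
  proof -
    have "x + axis k 1 + s *\<^sub>R axis i 1 = (x + s *\<^sub>R axis i 1) + axis k 1" by simp
    then show ?thesis using per unfolding periodic_def by (simp only: simp_thms)
  qed
  with D[of "x + axis k 1"] have "((\<lambda>s. f (x + s *\<^sub>R axis i 1)) has_real_derivative pd i f (x + axis k 1)) (at 0)"
    by simp
  from DERIV_unique[OF this D[of x]] show "pd i f (x + axis k 1) = pd i f x" .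
qed

text \<open>With \<open>S\<close> the oscillation of \<open>f\<close>, \<open>A\<close> the \<open>L^2\<close> norm of the gradient and \<open>N\<close> that of the
  Hessian, the Taylor estimate gives \<open>S \<le> 3 A + 18 N\<close>, and integration by parts \<open>A^2 \<le> 3 S N\<close>.\<close>

lemma cell_sobolev:
  assumes f: "Ck 2 f" and per: "periodic f"
  shows "integral cell (\<lambda>x. (norm (grad f x))\<^sup>2) \<le> 196 * hess_energy f"
    and "\<And>x y. x \<in> cell \<Longrightarrow> y \<in> cell \<Longrightarrow> \<bar>f x - f y\<bar> \<le> 120 * sqrt (hess_energy f)"
proof -
  note f1 = Ck_2_D(1)[OF f] and pf1 = Ck_2_D(2)[OF f]
  define N where "N = sqrt (hess_energy f)"
  define A where "A = sqrt (integral cell (\<lambda>x. (norm (grad f x))\<^sup>2))"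
  define m where "m = integral cell f"
  have N0: "0 \<le> N" by (simp add: N_def hess_energy_nonneg f)
  have A0: "0 \<le> A"
    unfolding A_def by (intro real_sqrt_ge_zero integral_nonneg integrable_on_cell
        continuous_intros continuous_on_grad f1) auto
  \<comment> \<open>The factor 3 is a crude bound for the diameter sqrt 3 of the cell.\<close>
  have osc: "\<bar>f x - m\<bar> \<le> 3 * A + 18 * N" if x: "x \<in> cell" for x
  proof -
    have i: "f integrable_on cell" "(\<lambda>y. grad f y \<bullet> (y - x)) integrable_on cell"
      by (intro integrable_on_cell continuous_intros continuous_on_grad Ck_1_continuous f1)+
    have "\<bar>integral cell (\<lambda>y. grad f y \<bullet> (y - x))\<bar> \<le> integral cell (\<lambda>y. 3 * norm (grad f y))"
      unfolding real_norm_def[symmetric]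
    proof (rule integral_norm_bound_integral)
      show "(\<lambda>y. 3 * norm (grad f y)) integrable_on cell"
        by (intro integrable_on_cell continuous_intros continuous_on_grad f1)
      show "norm (grad f y \<bullet> (y - x)) \<le> 3 * norm (grad f y)" if "y \<in> cell" for y
      proof -
        have "(norm (y - x))\<^sup>2 \<le> 3\<^sup>2"
          using norm_diff_cell[OF x that] by simp
        then have "norm (y - x) \<le> 3" by (rule power2_le_imp_le) simp
        then have "norm (grad f y) * norm (y - x) \<le> norm (grad f y) * 3"
          by (intro mult_left_mono) auto
        then show ?thesis using Cauchy_Schwarz_ineq2[of "grad f y" "y - x"] by simp
      qed
    qed fact
    also have "\<dots> \<le> 3 * A"
      using integral_cell_le_sqrt[OF continuous_on_grad[OF f1]] by (simp add: A_def)
    finally have "\<bar>integral cell (\<lambda>y. grad f y \<bullet> (y - x))\<bar> \<le> 3 * A" .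
    moreover have "\<bar>m - integral cell (\<lambda>y. grad f y \<bullet> (y - x)) - f x\<bar> \<le> 18 * N"
      using cell_taylor[OF f x] i by (simp add: m_def N_def Henstock_Kurzweil_Integration.integral_diff)
    ultimately show ?thesis by linarith
  qed
  \<comment> \<open>\<open>?h'\<close> is the \<open>i\<close>-th derivative of the periodic
    function \<open>(f x - m) * pd i f x\<close>, so its integral vanishes. The remaining term is
    bounded by the oscillation times the L^1 norm of the Hessian.\<close>
  have by_parts: "integral cell (\<lambda>x. (pd i f x)\<^sup>2) \<le> (3 * A + 18 * N) * N" for i
  proof -
    let ?h' = "\<lambda>x. (pd i f x)\<^sup>2 + (f x - m) * pd i (pd i f) x"
    have pc: "continuous_on S f" "continuous_on S (pd i f)" "continuous_on S (pd i (pd i f))" for S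
      by (intro Ck_1_continuous continuous_on_pd f1 pf1)+
    have D: "((\<lambda>s. q (x + s *\<^sub>R axis i 1)) has_real_derivative pd i q (x + s *\<^sub>R axis i 1)) (at s)"
      if "Ck 1 q" for q x s
      using has_real_derivative_along_line[OF that, of x "axis i 1" s]
      by (simp add: inner_axis grad_def)
    have "integral cell ?h' = 0"
    proof (rule integral_cell_directional_derivative[where h="\<lambda>x. (f x - m) * pd i f x" and k=i])
      show "((\<lambda>s. (f (x + s *\<^sub>R axis i 1) - m) * pd i f (x + s *\<^sub>R axis i 1))
          has_real_derivative ?h' (x + s *\<^sub>R axis i 1)) (at s)" for x s
        by (rule derivative_eq_intros D f1 pf1 refl)+ (simp add: power2_eq_square)
      show "periodic (\<lambda>x. (f x - m) * pd i f x)"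
        using per periodic_pd[OF f1 per, of i] by (simp add: periodic_def)
    qed (intro continuous_intros pc)+
    then have "integral cell (\<lambda>x. (pd i f x)\<^sup>2) = - integral cell (\<lambda>x. (f x - m) * pd i (pd i f) x)"
      by (subst (asm) Henstock_Kurzweil_Integration.integral_add)
         (auto intro!: integrable_on_cell continuous_intros pc)
    also have "\<dots> \<le> norm (integral cell (\<lambda>x. (f x - m) * pd i (pd i f) x))"
      by simp
    also have "\<dots> \<le> integral cell (\<lambda>x. (3 * A + 18 * N) * norm (hess f x))"
    proof (rule integral_norm_bound_integral)
      show "(\<lambda>x. (f x - m) * pd i (pd i f) x) integrable_on cell"
        "(\<lambda>x. (3 * A + 18 * N) * norm (hess f x)) integrable_on cell"
        by (intro integrable_on_cell continuous_intros pc continuous_on_hess f)+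
      show "norm ((f x - m) * pd i (pd i f) x) \<le> (3 * A + 18 * N) * norm (hess f x)"
        if "x \<in> cell" for x
      proof -
        have "\<bar>pd i (pd i f) x\<bar> = norm (hess f x $ i $ i)" by (simp add: hess_def)
        also have "\<dots> \<le> norm (hess f x $ i)" by (rule Finite_Cartesian_Product.norm_nth_le)
        also have "\<dots> \<le> norm (hess f x)" by (rule Finite_Cartesian_Product.norm_nth_le)
        finally show ?thesis
          unfolding real_norm_def abs_mult using osc[OF that] by (intro mult_mono) auto
      qed
    qed
    also have "\<dots> = (3 * A + 18 * N) * integral cell (\<lambda>x. norm (hess f x))"
      by simp
    also have "\<dots> \<le> (3 * A + 18 * N) * N"
      unfolding N_def hess_energy_def using A0 N0
      by (intro mult_left_mono integral_cell_le_sqrt continuous_on_hess f)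
         (auto simp: N_def hess_energy_def)
    finally show ?thesis .
  qed
  have "A\<^sup>2 = integral cell (\<lambda>x. \<Sum>i\<in>UNIV. (pd i f x)\<^sup>2)"
  proof -
    have "(norm (grad f x))\<^sup>2 = (\<Sum>i\<in>UNIV. (pd i f x)\<^sup>2)" for x
      unfolding power2_norm_eq_inner by (simp add: inner_vec_def grad_def power2_eq_square)
    then show ?thesis using A0 by (simp add: A_def)
  qed
  also have "\<dots> = (\<Sum>i\<in>UNIV. integral cell (\<lambda>x. (pd i f x)\<^sup>2))"
    by (intro integral_sum integrable_on_cell continuous_intros continuous_on_pd f1) auto
  also have "\<dots> \<le> (\<Sum>i\<in>(UNIV::3 set). (3 * A + 18 * N) * N)"
    by (intro sum_mono by_parts)
  finally have quad: "A\<^sup>2 \<le> 9 * A * N + 54 * N\<^sup>2"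
    by (simp add: power2_eq_square algebra_simps)
  \<comment> \<open>14 is large enough because 14 * (14 - 9) = 70 exceeds the 54 of the quadratic
    inequality; the strict positivity of \<open>A * (A - 9 * N)\<close> settles the case N =
    0.\<close>
  have A_le: "A \<le> 14 * N"
  proof (rule ccontr)
    assume "\<not> A \<le> 14 * N"
    then have "14 * N < A" by simp
    then have "(14 * N) * (5 * N) \<le> A * (A - 9 * N)" "0 < A * (A - 9 * N)"
      using N0 by (rule_tac mult_mono, simp_all)
    moreover have "A * (A - 9 * N) \<le> 54 * N\<^sup>2"
      using quad by (simp add: power2_eq_square algebra_simps)
    moreover have "0 \<le> N\<^sup>2" by simp
    ultimately show False by (simp add: power2_eq_square)
  qed
  have "A\<^sup>2 \<le> (14 * N)\<^sup>2"
    using A_le A0 by (intro power_mono) auto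
  then show "integral cell (\<lambda>x. (norm (grad f x))\<^sup>2) \<le> 196 * hess_energy f"
    using A0 N0 by (simp add: A_def N_def power_mult_distrib)
  \<comment> \<open>Both values are within 3 * 14 N + 18 N = 60 N of the mean, whence 120.\<close>
  show "\<bar>f x - f y\<bar> \<le> 120 * sqrt (hess_energy f)" if "x \<in> cell" "y \<in> cell" for x y
    using osc[OF that(1)] osc[OF that(2)] A_le unfolding N_def[symmetric] by linarith
qed

section \<open>Coercivity of the dissipation near the constant state\<close>

lemma oriented_integral_has_derivative:
  fixes g :: "real \<Rightarrow> real"
  assumes g: "continuous_on {0<..} g" and y: "0 < y"
  shows "((\<lambda>u. LBINT \<tau>=1..ereal u. g \<tau>) has_real_derivative g y) (at y)"
proof -
  \<comment> \<open>A compact interval of positive numbers with both the base point 1 and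
    \<open>y\<close> in its interior, on whichever side of 1 the point \<open>y\<close>
    lies.\<close>
  define a b where "a = min 1 y / 2" and "b = max 1 y + 1"
  have ab: "0 < a" "a < 1" "1 < b" "a < y" "y < b" using y by (auto simp: a_def b_def)
  have "((\<lambda>u. LBINT \<tau>=ereal 1..ereal u. g \<tau>) has_vector_derivative g y) (at y within {a..b})"
    by (rule interval_integral_FTC2) (use ab in \<open>auto intro: continuous_on_subset[OF g]\<close>)
  moreover have "at y within {a..b} = at y"
    by (rule at_within_interior) (use ab in auto)
  ultimately show ?thesis
    by (simp add: has_real_derivative_iff_has_vector_derivative one_ereal_def)
qed

lemma potential_has_derivative:
  assumes f: "continuous_on {0<..} f" and y: "0 < y"
  shows "(potential f has_real_derivative (LBINT \<tau>=1..ereal y. f \<tau> / \<tau>\<^sup>2) + f y / y) (at y)"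
proof -
  have "continuous_on {0<..} (\<lambda>\<tau>. f \<tau> / \<tau>\<^sup>2)"
    by (intro continuous_intros f) auto
  from DERIV_mult[OF DERIV_ident oriented_integral_has_derivative[OF this y]]
  show ?thesis using y
    by (simp add: potential_def[abs_def] power2_eq_square mult.commute)
qed

text \<open>Differentiating the integral and the quotient produces f y / y^2 with opposite signs, so
  only f' y / y survives. It is the convexity of the potentials and the source of their quadratic
  bound.\<close>

lemma deriv_potential_has_derivative:
  assumes f: "\<And>y. 0 < y \<Longrightarrow> f differentiable (at y)" and y: "0 < y"
  shows "(deriv (potential f) has_real_derivative deriv f y / y) (at y)"
proof -
  have cf: "continuous_on {0<..} f"
    using f by (auto intro!: continuous_at_imp_continuous_on differentiable_imp_continuous_within)
  then have c: "continuous_on {0<..} (\<lambda>\<tau>. f \<tau> / \<tau>\<^sup>2)"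
    by (intro continuous_intros) auto
  have Df: "(f has_real_derivative deriv f y) (at y)"
    using f[OF y] by (simp add: DERIV_deriv_iff_real_differentiable)
  have "((\<lambda>y. (LBINT \<tau>=1..ereal y. f \<tau> / \<tau>\<^sup>2) + f y / y) has_real_derivative deriv f y / y) (at y)"
    using DERIV_add[OF oriented_integral_has_derivative[OF c y] DERIV_divide[OF Df DERIV_ident]] y
    by (simp add: field_simps power2_eq_square)
  \<comment> \<open>The formula for the first derivative is available at positive points, hence near
    \<open>y\<close>, which is enough to differentiate once more.\<close>
  moreover have "\<forall>\<^sub>F z in nhds y. deriv (potential f) z = (LBINT \<tau>=1..ereal z. f \<tau> / \<tau>\<^sup>2) + f z / z"
    by (rule eventually_mono[OF eventually_nhds_in_open[of "{0<..}" y]])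
       (use y in \<open>auto intro: DERIV_imp_deriv potential_has_derivative cf\<close>)
  ultimately show ?thesis
    by (subst DERIV_cong_ev[OF refl _ refl])
qed

text \<open>The second derivative is bounded by some \<open>L\<close> on the compact interval, so
  the first derivative is \<open>L\<close>-Lipschitz there. By the mean value theorem the relative
  potential is (y - r) times an increment of the first derivative.\<close>

lemma relative_potential_le_square:
  fixes r :: real
  assumes f: "\<And>y. 0 < y \<Longrightarrow> f differentiable (at y)" and cf': "continuous_on {0<..} (deriv f)"
    and r: "0 < r"
  shows "\<exists>L\<ge>0. \<forall>y\<in>{r/2..2*r}. relative (potential f) y r \<le> L * (y - r)\<^sup>2"
proof -
  let ?F = "potential f"
  have cf: "continuous_on {0<..} f"
    using f by (auto intro!: continuous_at_imp_continuous_on differentiable_imp_continuous_within)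
  have D1: "(?F has_real_derivative deriv ?F y) (at y)" if "0 < y" for y
    using potential_has_derivative[OF cf that] by (simp add: DERIV_imp_deriv)
  note D2 = deriv_potential_has_derivative[OF f]
  have "continuous_on {r/2..2*r} (\<lambda>y. deriv f y / y)"
    using r by (intro continuous_intros continuous_on_subset[OF cf']) auto
  then have "bounded ((\<lambda>y. deriv f y / y) ` {r/2..2*r})"
    by (intro compact_imp_bounded compact_continuous_image) auto
  then obtain L where "\<forall>z\<in>(\<lambda>y. deriv f y / y) ` {r/2..2*r}. norm z \<le> L"
    unfolding bounded_iff by blast
  then have L: "\<bar>deriv f y / y\<bar> \<le> L" if "y \<in> {r/2..2*r}" for y
    using bspec[OF _ imageI[OF that]] by (simp only: real_norm_def)
  have L0: "0 \<le> L" using order_trans[OF abs_ge_zero L[of r]] r by simp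
  have Lip: "\<bar>deriv ?F y - deriv ?F r\<bar> \<le> L * \<bar>y - r\<bar>" if y: "y \<in> {r/2..2*r}" for y
    unfolding real_norm_def[symmetric]
  proof (rule field_differentiable_bound[of "{r/2..2*r}" _ "\<lambda>y. deriv f y / y"])
    show "(deriv ?F has_field_derivative deriv f z / z) (at z within {r/2..2*r})"
      if "z \<in> {r/2..2*r}" for z
      by (rule has_field_derivative_at_within, rule D2) (use that r in auto)
  qed (use L y r in auto)
  have "relative ?F y r \<le> L * (y - r)\<^sup>2" if y: "y \<in> {r/2..2*r}" for y
  proof -
    obtain z where z: "min y r \<le> z" "z \<le> max y r" "?F y - ?F r = (y - r) * deriv ?F z"
    proof (cases y r rule: linorder_cases)
      case less
      have "\<exists>z>y. z < r \<and> ?F r - ?F y = (r - y) * deriv ?F z"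
        by (rule MVT2[OF less D1]) (use y r in auto)
      then obtain z where "y < z" "z < r" "?F r - ?F y = (r - y) * deriv ?F z"
        by blast
      then show ?thesis using less by (intro that[of z]) (auto simp: algebra_simps)
    next
      case greater
      have "\<exists>z>r. z < y \<and> ?F y - ?F r = (y - r) * deriv ?F z"
        by (rule MVT2[OF greater D1]) (use y r in auto)
      then obtain z where "r < z" "z < y" "?F y - ?F r = (y - r) * deriv ?F z"
        by blast
      then show ?thesis using greater by (intro that[of z]) auto
    qed (auto intro: that[of y])
    have "relative ?F y r = (y - r) * (deriv ?F z - deriv ?F r)"
      by (simp add: relative_def z(3) algebra_simps)
    also have "\<dots> \<le> \<bar>y - r\<bar> * \<bar>deriv ?F z - deriv ?F r\<bar>"
      by (metis abs_ge_self abs_mult)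
    also have "\<dots> \<le> \<bar>y - r\<bar> * (L * \<bar>y - r\<bar>)"
    proof -
      have "z \<in> {r/2..2*r}" using z y r by auto
      moreover have "L * \<bar>z - r\<bar> \<le> L * \<bar>y - r\<bar>" using z L0 by (intro mult_left_mono) auto
      ultimately show ?thesis using Lip[of z] by (intro mult_left_mono) auto
    qed
    finally show ?thesis by (simp add: power2_eq_square abs_mult_self mult.left_commute)
  qed
  with L0 show ?thesis by blast
qed

section \<open>Constitutive functions away from the vacuum\<close>

lemma viscosity_facts:
  assumes "V1 \<mu> lam" and "V2 \<mu> \<alpha>1 \<alpha>2"
  shows "\<And>y. 0 < y \<Longrightarrow> \<mu> differentiable (at y)" and "continuous_on {0<..} \<mu>"
    and "continuous_on {0<..} (deriv \<mu>)"
    and "\<And>y. 0 < y \<Longrightarrow> 0 < \<mu> y" and "\<And>y. 0 < y \<Longrightarrow> 0 < deriv \<mu> y"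
proof -
  show "\<mu> differentiable (at y)" if "0 < y" for y
    using assms(1) that by (auto simp: V1_def)
  then show "continuous_on {0<..} \<mu>"
    by (auto intro!: continuous_at_imp_continuous_on differentiable_imp_continuous_within)
  show "continuous_on {0<..} (deriv \<mu>)"
    using assms(1) unfolding V1_def
    by (auto intro!: continuous_at_imp_continuous_on differentiable_imp_continuous_within)
  have "0 < \<alpha>2" using assms(2) by (simp add: V2_def)
  moreover have *: "0 < 1 / \<alpha>2 * (y * deriv \<mu> y)" "1 / \<alpha>2 * (y * deriv \<mu> y) \<le> \<mu> y" if "0 < y" for y
    using assms(2) that by (auto simp only: V2_def)
  ultimately show "0 < deriv \<mu> y" if "0 < y" for y
    using *(1)[OF that] that by (simp add: zero_less_divide_iff zero_less_mult_iff)
  show "0 < \<mu> y" if "0 < y" for y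
    using *[OF that] by linarith
qed

lemma Z_fun_has_derivative:
  assumes "V1 \<mu> lam" "V2 \<mu> \<alpha>1 \<alpha>2" and "0 < y"
  shows "(Z_fun \<mu> has_real_derivative sqrt (\<mu> y) * deriv \<mu> y / y) (at y)"
  unfolding Z_fun_def[abs_def]
  by (rule oriented_integral_has_derivative)
     (use assms viscosity_facts[OF assms(1,2)] in \<open>auto intro!: continuous_intros\<close>)

lemma s_fun_has_derivative:
  assumes "V1 \<mu> lam" "V2 \<mu> \<alpha>1 \<alpha>2" and "0 < y"
  shows "(s_fun \<mu> has_real_derivative deriv \<mu> y / y) (at y)"
  unfolding s_fun_def[abs_def]
  by (rule oriented_integral_has_derivative)
     (use assms viscosity_facts[OF assms(1,2)] in \<open>auto intro!: continuous_intros\<close>)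

lemma pressure_facts:
  shows "0 < y \<Longrightarrow> (pressure a \<gamma> has_real_derivative a * \<gamma> * y powr (\<gamma> - 1)) (at y)"
    and "0 < y \<Longrightarrow> pressure a \<gamma> differentiable (at y)"
    and "continuous_on {0<..} (deriv (pressure a \<gamma>))"
    and "0 < y \<Longrightarrow> deriv (pressure a \<gamma>) y = a * \<gamma> * y powr (\<gamma> - 1)"
proof -
  show D: "(pressure a \<gamma> has_real_derivative a * \<gamma> * y powr (\<gamma> - 1)) (at y)" if "0 < y" for y
    unfolding pressure_def[abs_def] using that by (auto intro!: derivative_eq_intros)
  then show "0 < y \<Longrightarrow> pressure a \<gamma> differentiable (at y)"
    using real_differentiable_def by blast
  have d: "deriv (pressure a \<gamma>) y = a * \<gamma> * y powr (\<gamma> - 1)" if "0 < y" for y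
    using D[OF that] by (rule DERIV_imp_deriv)
  then show "0 < y \<Longrightarrow> deriv (pressure a \<gamma>) y = a * \<gamma> * y powr (\<gamma> - 1)" .
  have "continuous_on {0<..} (\<lambda>y. a * \<gamma> * y powr (\<gamma> - 1))"
    by (intro continuous_intros) auto
  then show "continuous_on {0<..} (deriv (pressure a \<gamma>))"
    by (rule continuous_on_eq) (simp add: d)
qed

text \<open>The outer function has to be differentiable only at the value \<open>\<rho> x\<close>;
  this allows \<open>Z_fun\<close> and \<open>s_fun\<close>, which may be singular at the
  vacuum.\<close>

lemma grad_compose:
  assumes \<rho>: "Ck 1 \<rho>" and g: "(g has_real_derivative g') (at (\<rho> x))"
  shows "grad (\<lambda>y. g (\<rho> y)) x = g' *\<^sub>R grad \<rho> x"
proof -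
  have "((\<lambda>y. g (\<rho> y)) has_derivative (\<lambda>d. g' * (grad \<rho> x \<bullet> d))) (at x)"
    using has_derivative_compose[OF Ck_1_derivative[OF \<rho>], of g "(*) g'"] g
    by (simp add: has_field_derivative_def)
  then have "frechet_derivative (\<lambda>y. g (\<rho> y)) (at x) = (\<lambda>d. g' * (grad \<rho> x \<bullet> d))"
    by (rule frechet_derivative_at[symmetric])
  then show ?thesis
    by (simp add: vec_eq_iff grad_def pd_def[of _ "\<lambda>y. g (\<rho> y)"] inner_axis)
qed

section \<open>Confinement of the density near its mean\<close>

lemma connected_compact_cell: "connected cell" "compact cell" "0 \<in> cell"
  by (simp_all add: cell_def convex_connected mem_box_cart)

text \<open>On a cell of volume one the integral lies between minimum and maximum, and the image of
  a connected set is an interval.\<close>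

lemma cell_attains_mean:
  fixes \<rho> :: "real^3 \<Rightarrow> real"
  assumes c: "continuous_on cell \<rho>"
  obtains x where "x \<in> cell" "\<rho> x = integral cell \<rho>"
proof -
  have ne: "cell \<noteq> {}" using connected_compact_cell(3) by auto
  obtain a where a: "a \<in> cell" "\<And>x. x \<in> cell \<Longrightarrow> \<rho> a \<le> \<rho> x"
    using continuous_attains_inf[OF connected_compact_cell(2) ne c] by blast
  obtain b where b: "b \<in> cell" "\<And>x. x \<in> cell \<Longrightarrow> \<rho> x \<le> \<rho> b"
    using continuous_attains_sup[OF connected_compact_cell(2) ne c] by blast
  have i: "\<rho> integrable_on cell" "(\<lambda>x. k) integrable_on cell" for k :: real
    by (rule integrable_on_cell, rule c)+ (rule integrable_on_cell, simp)
  have "integral cell (\<lambda>x. \<rho> a) \<le> integral cell \<rho>"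
    by (rule integral_le[OF i(2,1) a(2)])
  moreover have "integral cell \<rho> \<le> integral cell (\<lambda>x. \<rho> b)"
    by (rule integral_le[OF i(1,2) b(2)])
  ultimately have "\<rho> a \<le> integral cell \<rho>" "integral cell \<rho> \<le> \<rho> b"
    by simp_all
  then have "integral cell \<rho> \<in> \<rho> ` cell"
    by (rule connectedD_interval[OF connected_continuous_image[OF c connected_compact_cell(1)]
          imageI[OF a(1)] imageI[OF b(1)]])
  then obtain x where "x \<in> cell" "\<rho> x = integral cell \<rho>" by (metis imageE)
  then show thesis by (rule that)
qed

text \<open>A density whose composition with \<open>Z\<close> has a small Hessian stays close to its mean, since \<open>Z\<close> is
  strictly increasing; the vacuum is thereby excluded without any knowledge of \<open>Z\<close> near 0.\<close>

lemma density_near_mean: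
  fixes r :: real and Z :: "real \<Rightarrow> real"
  assumes r: "0 < r" and Z: "\<And>y. 0 < y \<Longrightarrow> (Z has_real_derivative Z' y) (at y)"
    and Z': "\<And>y. 0 < y \<Longrightarrow> 0 < Z' y"
  obtains \<delta> where "0 < \<delta>" and
    "\<And>\<rho> x. \<lbrakk>Ck 1 \<rho>; Ck 2 (\<lambda>x. Z (\<rho> x)); periodic \<rho>; integral cell \<rho> = r;
      hess_energy (\<lambda>x. Z (\<rho> x)) < \<delta>; x \<in> cell\<rbrakk> \<Longrightarrow>
      \<rho> x \<in> {r/2..2*r} \<and> \<bar>Z (\<rho> x) - Z r\<bar> \<le> 120 * sqrt (hess_energy (\<lambda>x. Z (\<rho> x)))"
proof -
  have mono: "Z a < Z b" if "0 < a" "a < b" for a b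
  proof (rule DERIV_pos_imp_increasing[OF that(2)])
    fix y assume "a \<le> y"
    then have "0 < y" using that by simp
    then show "\<exists>D. (Z has_real_derivative D) (at y) \<and> 0 < D" using Z Z' by blast
  qed
  \<comment> \<open>\<open>d\<close> is the smaller gap of \<open>Z\<close> between \<open>r\<close>
    and the ends of [r/2, 2 r]. Below, the threshold (d / 120)^2 makes the Sobolev bound 120 sqrt S
    smaller than \<open>d\<close>.\<close>
  define d where "d = min (Z r - Z (r/2)) (Z (2*r) - Z r)"
  have d: "0 < d" using mono[of "r/2" r] mono[of r "2*r"] r by (simp add: d_def)
  show thesis
  proof (rule that[where \<delta>="(d / 120)\<^sup>2"])
    show "0 < (d / 120)\<^sup>2" using d by simp
  next
    fix \<rho> x
    assume \<rho>: "Ck 1 \<rho>" "Ck 2 (\<lambda>x. Z (\<rho> x))" "periodic \<rho>" "integral cell \<rho> = r" and x: "x \<in> cell"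
      and small: "hess_energy (\<lambda>x. Z (\<rho> x)) < (d / 120)\<^sup>2"
    let ?S = "hess_energy (\<lambda>x. Z (\<rho> x))"
    obtain x0 where x0: "x0 \<in> cell" "\<rho> x0 = r"
      using cell_attains_mean[OF Ck_1_continuous[OF \<rho>(1)]] \<rho>(4) by metis
    have "periodic (\<lambda>x. Z (\<rho> x))" using \<rho>(3) by (simp add: periodic_def)
    then have osc: "\<bar>Z (\<rho> y) - Z r\<bar> \<le> 120 * sqrt ?S" if "y \<in> cell" for y
      using cell_sobolev(2)[OF \<rho>(2) _ that x0(1)] x0(2) by simp
    have "sqrt ?S < d / 120"
      using real_sqrt_less_mono[OF small] d by simp
    then have far: "\<bar>Z (\<rho> y) - Z r\<bar> < d" if "y \<in> cell" for y
      using osc[OF that] by linarith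
    \<comment> \<open>Since the density attains \<open>r\<close>, leaving [r/2, 2 r] would force it
      to take the value r/2 or 2 r somewhere, where \<open>Z\<close> is at least \<open>d\<close>
      away from \<open>Z r\<close>. Thus \<open>Z\<close> is compared at positive arguments
      only.\<close>
    have ivt: "\<exists>y\<in>cell. \<rho> y = c" if "\<rho> x \<le> c \<and> c \<le> r \<or> r \<le> c \<and> c \<le> \<rho> x" for c
    proof -
      have "connected (\<rho> ` cell)"
        by (intro connected_continuous_image Ck_1_continuous \<rho>(1) connected_compact_cell)
      moreover have "\<rho> x \<in> \<rho> ` cell" "r \<in> \<rho> ` cell"
        using x x0 by (auto intro: rev_image_eqI)
      ultimately have "c \<in> \<rho> ` cell"
        using that connectedD_interval[of "\<rho> ` cell" "\<rho> x" r c]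
          connectedD_interval[of "\<rho> ` cell" r "\<rho> x" c] by blast
      then show ?thesis by auto
    qed
    have "r / 2 \<le> \<rho> x"
    proof (rule ccontr)
      assume "\<not> r / 2 \<le> \<rho> x"
      then obtain y where "y \<in> cell" "\<rho> y = r / 2" using ivt[of "r/2"] r by auto
      then show False using far[of y] by (auto simp: d_def)
    qed
    moreover have "\<rho> x \<le> 2 * r"
    proof (rule ccontr)
      assume "\<not> \<rho> x \<le> 2 * r"
      then obtain y where "y \<in> cell" "\<rho> y = 2 * r" using ivt[of "2*r"] r by auto
      then show False using far[of y] by (auto simp: d_def)
    qed
    ultimately show "\<rho> x \<in> {r/2..2*r} \<and> \<bar>Z (\<rho> x) - Z r\<bar> \<le> 120 * sqrt ?S"
      using osc[OF x] by simp
  qed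
qed

section \<open>Entropy controlled by dissipation\<close>

text \<open>Every constant is built from extrema over the compact interval [r/2, 2 r] and from the
  parameters, so \<open>\<delta>\<close> and \<open>K\<close> are the same for all fields.\<close>

lemma entropy_le_dissipation_near_constant:
  assumes \<mu>: "V1 \<mu> lam" "V2 \<mu> \<alpha>1 \<alpha>2"
    and pos: "0 < r" "0 < r2" "0 < \<epsilon>" "0 < \<kappa>" "\<kappa> < 1"
  obtains \<delta> K where "0 < \<delta>" "0 < K" and
    "\<And>\<rho> u v w. \<lbrakk>Ck 1 \<rho>; Ck 2 (\<lambda>x. Z_fun \<mu> (\<rho> x)); periodic \<rho>; integral cell \<rho> = r;
      \<And>x. v x = (if 0 < \<rho> x then 2 *\<^sub>R grad (\<lambda>y. s_fun \<mu> (\<rho> y)) x else 0);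
      \<And>x. w x = u x + \<kappa> *\<^sub>R v x; \<And>x. 0 \<le> \<rho> x;
      integrable torus (\<lambda>x. r2 * \<rho> x * (norm (u x))\<^sup>2);
      hess_energy (\<lambda>x. Z_fun \<mu> (\<rho> x)) < \<delta>\<rbrakk> \<Longrightarrow>
      relative_entropy \<mu> a \<gamma> \<epsilon> r2 \<kappa> r \<rho> w v
        \<le> ennreal (K * (hess_energy (\<lambda>x. Z_fun \<mu> (\<rho> x)) + (\<integral>x. r2 * \<rho> x * (norm (u x))\<^sup>2 \<partial>torus)))"
proof -
  note visc = viscosity_facts[OF \<mu>]
  let ?Z = "Z_fun \<mu>" and ?I = "{r/2..2*r}"
  define Z' where "Z' y = sqrt (\<mu> y) * deriv \<mu> y / y" for y
  have DZ: "(?Z has_real_derivative Z' y) (at y)" if "0 < y" for y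
    using Z_fun_has_derivative[OF \<mu> that] by (simp add: Z'_def)
  have Z'_pos: "0 < Z' y" if "0 < y" for y
    using visc(4,5) that by (simp add: Z'_def)
  have I_pos: "0 < y" if "y \<in> ?I" for y using that pos by auto
  have compI: "compact ?I" "?I \<noteq> {}" using pos by auto
  have contI: "continuous_on ?I \<mu>" "continuous_on ?I (deriv \<mu>)"
    using pos by (auto intro: continuous_on_subset visc(2,3))
  have "continuous_on ?I Z'"
    unfolding Z'_def using pos by (intro continuous_intros contI) auto
  from continuous_attains_inf[OF compI this] obtain y0 where y0: "y0 \<in> ?I" "\<And>y. y \<in> ?I \<Longrightarrow> Z' y0 \<le> Z' y"
    by blast
  \<comment> \<open>\<open>c\<close> is the least slope of \<open>Z\<close> on the interval; it
    turns closeness of \<open>Z(\<rho>)\<close> to \<open>Z(r)\<close> into closeness of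
    \<open>\<rho>\<close> to \<open>r\<close>.\<close>
  define c where "c = Z' y0"
  have c: "0 < c" unfolding c_def by (intro Z'_pos I_pos y0(1))
  have Z_lower: "(y - r)\<^sup>2 \<le> (?Z y - ?Z r)\<^sup>2 / c\<^sup>2" if y: "y \<in> ?I" for y
  proof -
    have up: "c * (b' - a') \<le> ?Z b' - ?Z a'" if ab: "a' \<in> ?I" "b' \<in> ?I" "a' \<le> b'" for a' b'
    proof -
      have "\<exists>D. ((\<lambda>s. ?Z s - c * s) has_real_derivative D) (at s) \<and> 0 \<le> D" if s: "a' \<le> s" "s \<le> b'" for s
      proof -
        have "s \<in> ?I" using s ab by auto
        then show ?thesis using y0(2)[of s] DZ[OF I_pos, of s]
          by (intro exI[of _ "Z' s - c"]) (auto intro!: derivative_eq_intros simp: c_def)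
      qed
      then have "?Z a' - c * a' \<le> ?Z b' - c * b'"
        by (intro DERIV_nonneg_imp_nondecreasing[OF ab(3), where f="\<lambda>s. ?Z s - c * s"]) blast
      then show ?thesis by (simp add: algebra_simps)
    qed
    have rI: "r \<in> ?I" using pos by auto
    have "c * \<bar>y - r\<bar> \<le> \<bar>?Z y - ?Z r\<bar>"
      using up[OF y rI] up[OF rI y] by (cases "y \<le> r") (auto simp: abs_if)
    then have "(c * \<bar>y - r\<bar>)\<^sup>2 \<le> \<bar>?Z y - ?Z r\<bar>\<^sup>2"
      using c by (intro power_mono) auto
    then show ?thesis using c by (simp add: power_mult_distrib pos_le_divide_eq mult.commute)
  qed
  have "continuous_on ?I (\<lambda>y. 4 * y / \<mu> y)"
    using visc(4)[OF I_pos] by (intro continuous_intros contI) fastforce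
  from continuous_attains_sup[OF compI this] obtain y1
    where y1: "y1 \<in> ?I" "\<And>y. y \<in> ?I \<Longrightarrow> 4 * y / \<mu> y \<le> 4 * y1 / \<mu> y1" by blast
  \<comment> \<open>Since v = 2 (\<mu>'/\<rho>) grad \<rho> and grad Z(\<rho>) = (sqrt \<mu>
    \<mu>'/\<rho>) grad \<rho>, one has \<rho> |v|^2 = (4 \<rho>/\<mu>) |grad Z(\<rho>)|^2;
    \<open>B\<close> is the maximum of the factor.\<close>
  define B where "B = 4 * y1 / \<mu> y1"
  have B: "0 < B" using visc(4)[OF I_pos[OF y1(1)]] I_pos[OF y1(1)] by (simp add: B_def)
  obtain L1 where L1: "0 \<le> L1" "\<And>y. y \<in> ?I \<Longrightarrow> relative (potential (pressure a \<gamma>)) y r \<le> L1 * (y - r)\<^sup>2"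
    using relative_potential_le_square[OF pressure_facts(2)[of _ a \<gamma>] pressure_facts(3)[of a \<gamma>] pos(1)] by metis
  obtain L2 where L2: "0 \<le> L2" "\<And>y. y \<in> ?I \<Longrightarrow> relative (potential \<mu>) y r \<le> L2 * (y - r)\<^sup>2"
    using relative_potential_le_square[OF visc(1,3) pos(1)] by metis
  \<comment> \<open>\<open>K1\<close> collects the coefficients of |v|^2 after |w|^2 \<le> 2 |u|^2 +
    2 \<kappa>^2 |v|^2. \<open>K2\<close> collects those of the potentials, with 14400 = 120^2 from
    the Sobolev bound. In \<open>K\<close>, 196 comes from the gradient estimate and 2 / r2 from the
    drag.\<close>
  define K1 where "K1 = (2 * \<kappa>\<^sup>2 + (\<kappa> * (1 - \<kappa>) + \<epsilon>)) * B"
  define K2 where "K2 = (L1 + 2 * \<kappa> * r2 * L2) * (14400 / c\<^sup>2)"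
  have coef: "0 \<le> \<kappa> * (1 - \<kappa>) + \<epsilon>" using pos by (intro add_nonneg_nonneg mult_nonneg_nonneg) auto
  have K1: "0 \<le> K1" unfolding K1_def using pos B coef by (intro mult_nonneg_nonneg add_nonneg_nonneg) auto
  have K2: "0 \<le> K2" unfolding K2_def using pos L1 L2 by (intro mult_nonneg_nonneg add_nonneg_nonneg) auto
  define K where "K = 2 / r2 + 196 * K1 + K2"
  have K: "0 < K" unfolding K_def using pos K1 K2 by (intro add_pos_nonneg) auto
  obtain \<delta> where \<delta>: "0 < \<delta>" and near:
    "\<And>\<rho> x. \<lbrakk>Ck 1 \<rho>; Ck 2 (\<lambda>x. ?Z (\<rho> x)); periodic \<rho>; integral cell \<rho> = r;
      hess_energy (\<lambda>x. ?Z (\<rho> x)) < \<delta>; x \<in> cell\<rbrakk> \<Longrightarrow>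
      \<rho> x \<in> ?I \<and> \<bar>?Z (\<rho> x) - ?Z r\<bar> \<le> 120 * sqrt (hess_energy (\<lambda>x. ?Z (\<rho> x)))"
    by (rule density_near_mean[OF pos(1) DZ Z'_pos]) blast+
  show thesis
  proof (rule that[OF \<delta> K])
    fix \<rho> :: "real^3 \<Rightarrow> real" and u v w :: "real^3 \<Rightarrow> real^3"
    assume \<rho>: "Ck 1 \<rho>" "Ck 2 (\<lambda>x. ?Z (\<rho> x))" "periodic \<rho>" "integral cell \<rho> = r"
      and v: "\<And>x. v x = (if 0 < \<rho> x then 2 *\<^sub>R grad (\<lambda>y. s_fun \<mu> (\<rho> y)) x else 0)"
      and w: "\<And>x. w x = u x + \<kappa> *\<^sub>R v x" and \<rho>0: "\<And>x. 0 \<le> \<rho> x"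
      and drag: "integrable torus (\<lambda>x. r2 * \<rho> x * (norm (u x))\<^sup>2)"
      and small: "hess_energy (\<lambda>x. ?Z (\<rho> x)) < \<delta>"
    define f where "f x = ?Z (\<rho> x)" for x
    define S where "S = hess_energy f"
    have f: "Ck 2 f" "periodic f"
      using \<rho>(2,3) by (simp_all add: f_def[abs_def] periodic_def)
    have S0: "0 \<le> S" unfolding S_def by (rule hess_energy_nonneg[OF f(1)])
    \<comment> \<open>The factor \<open>r2\<close> is kept inside the drag term because it is in
      this form that the drag is integrable.\<close>
    define bound where "bound x = 2 / r2 * (r2 * \<rho> x * (norm (u x))\<^sup>2) + (K1 * (norm (grad f x))\<^sup>2 + K2 * S)" for x
    have pointwise: "\<rho> x * ((norm (w x))\<^sup>2 + (\<kappa> * (1 - \<kappa>) + \<epsilon>) * (norm (v x))\<^sup>2)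
        + relative (potential (pressure a \<gamma>)) (\<rho> x) r
        + 2 * \<kappa> * r2 * relative (potential \<mu>) (\<rho> x) r \<le> bound x" if x: "x \<in> cell" for x
    proof -
      have I: "\<rho> x \<in> ?I" and osc: "\<bar>?Z (\<rho> x) - ?Z r\<bar> \<le> 120 * sqrt S"
        using near[OF \<rho> small x] by (auto simp: S_def f_def[abs_def])
      have \<rho>x: "0 < \<rho> x" using I_pos[OF I] .
      have "(?Z (\<rho> x) - ?Z r)\<^sup>2 \<le> (120 * sqrt S)\<^sup>2"
        using power_mono[OF osc abs_ge_zero, of 2] by simp
      then have "(?Z (\<rho> x) - ?Z r)\<^sup>2 / c\<^sup>2 \<le> 14400 * S / c\<^sup>2"
        using S0 by (intro divide_right_mono) (auto simp: power_mult_distrib)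
      then have sq: "(\<rho> x - r)\<^sup>2 \<le> 14400 / c\<^sup>2 * S"
        using Z_lower[OF I] by simp
      have "relative (potential (pressure a \<gamma>)) (\<rho> x) r + 2 * \<kappa> * r2 * relative (potential \<mu>) (\<rho> x) r
          \<le> L1 * (\<rho> x - r)\<^sup>2 + 2 * \<kappa> * r2 * (L2 * (\<rho> x - r)\<^sup>2)"
        using pos by (intro add_mono mult_left_mono L1(2) L2(2) I) auto
      also have "\<dots> = (L1 + 2 * \<kappa> * r2 * L2) * (\<rho> x - r)\<^sup>2"
        by (simp add: algebra_simps)
      also have "\<dots> \<le> (L1 + 2 * \<kappa> * r2 * L2) * (14400 / c\<^sup>2 * S)"
        using sq pos L1(1) L2(1) by (intro mult_left_mono add_nonneg_nonneg mult_nonneg_nonneg) auto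
      finally have potentials: "relative (potential (pressure a \<gamma>)) (\<rho> x) r
          + 2 * \<kappa> * r2 * relative (potential \<mu>) (\<rho> x) r \<le> K2 * S"
        by (simp only: K2_def mult.assoc)
      have gf: "grad f x = Z' (\<rho> x) *\<^sub>R grad \<rho> x"
        unfolding f_def by (rule grad_compose[OF \<rho>(1) DZ[OF \<rho>x]])
      have "v x = (2 * (deriv \<mu> (\<rho> x) / \<rho> x)) *\<^sub>R grad \<rho> x"
        using v[of x] \<rho>x grad_compose[OF \<rho>(1) s_fun_has_derivative[OF \<mu> \<rho>x]] by simp
      then have "\<rho> x * (norm (v x))\<^sup>2 = 4 * \<rho> x / \<mu> (\<rho> x) * (norm (grad f x))\<^sup>2"
        using \<rho>x visc(4)[OF \<rho>x] by (simp add: gf Z'_def power_mult_distrib field_simps)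
      also have "\<dots> \<le> B * (norm (grad f x))\<^sup>2"
        using y1(2)[OF I] by (intro mult_right_mono) (auto simp: B_def)
      finally have v_le: "\<rho> x * (norm (v x))\<^sup>2 \<le> B * (norm (grad f x))\<^sup>2" .
      have "(norm (w x))\<^sup>2 \<le> 2 * (norm (u x))\<^sup>2 + 2 * \<kappa>\<^sup>2 * (norm (v x))\<^sup>2"
      proof -
        have "norm (w x) \<le> norm (u x) + \<kappa> * norm (v x)"
          using norm_triangle_ineq[of "u x" "\<kappa> *\<^sub>R v x"] pos by (simp add: w)
        then have "(norm (w x))\<^sup>2 \<le> (norm (u x) + \<kappa> * norm (v x))\<^sup>2"
          by (intro power_mono) auto
        also have "\<dots> \<le> 2 * (norm (u x))\<^sup>2 + 2 * (\<kappa> * norm (v x))\<^sup>2"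
          using zero_le_power2[of "norm (u x) - \<kappa> * norm (v x)"]
          by (simp add: power2_eq_square algebra_simps)
        finally show ?thesis by (simp add: power_mult_distrib)
      qed
      then have "\<rho> x * ((norm (w x))\<^sup>2 + (\<kappa> * (1 - \<kappa>) + \<epsilon>) * (norm (v x))\<^sup>2)
          \<le> \<rho> x * ((2 * (norm (u x))\<^sup>2 + 2 * \<kappa>\<^sup>2 * (norm (v x))\<^sup>2) + (\<kappa> * (1 - \<kappa>) + \<epsilon>) * (norm (v x))\<^sup>2)"
        using \<rho>x by (intro mult_left_mono add_right_mono) auto
      also have "\<dots> = 2 * \<rho> x * (norm (u x))\<^sup>2 + (2 * \<kappa>\<^sup>2 + (\<kappa> * (1 - \<kappa>) + \<epsilon>)) * (\<rho> x * (norm (v x))\<^sup>2)"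
        by (simp add: algebra_simps)
      also have "\<dots> \<le> 2 * \<rho> x * (norm (u x))\<^sup>2 + (2 * \<kappa>\<^sup>2 + (\<kappa> * (1 - \<kappa>) + \<epsilon>)) * (B * (norm (grad f x))\<^sup>2)"
        using coef pos by (intro add_left_mono mult_left_mono v_le) auto
      finally show ?thesis
        using potentials pos by (simp add: bound_def K1_def)
    qed
    have "continuous_on cell (\<lambda>x. (norm (grad f x))\<^sup>2)"
      by (intro continuous_intros continuous_on_grad Ck_2_D f)
    note grad_torus = integral_torus_continuous[OF this]
    have gf: "integrable torus (\<lambda>x. (norm (grad f x))\<^sup>2)"
      "(\<integral>x. (norm (grad f x))\<^sup>2 \<partial>torus) \<le> 196 * S"
      using cell_sobolev(1)[OF f] grad_torus by (simp_all add: S_def)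
    have const: "integrable torus (\<lambda>x. K2 * S)" "(\<integral>x. K2 * S \<partial>torus) = K2 * S"
      using integral_torus_continuous[of "\<lambda>x. K2 * S"] by auto
    have int: "integrable torus bound"
      unfolding bound_def
      by (rule Bochner_Integration.integrable_add integrable_mult_right drag gf(1) const(1))+
    let ?D = "\<integral>x. r2 * \<rho> x * (norm (u x))\<^sup>2 \<partial>torus"
    have D0: "0 \<le> ?D" using \<rho>0 pos by (intro Bochner_Integration.integral_nonneg) auto
    have bound_nonneg: "0 \<le> bound x" for x
      unfolding bound_def using \<rho>0[of x] pos K1 K2 S0 
      by (intro add_nonneg_nonneg mult_nonneg_nonneg) auto
    have "relative_entropy \<mu> a \<gamma> \<epsilon> r2 \<kappa> r \<rho> w v \<le> (\<integral>\<^sup>+x. ennreal (bound x) \<partial>torus)"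
      unfolding relative_entropy_def
      by (intro nn_integral_mono ennreal_leI pointwise) (simp add: torus_def)
    also have "\<dots> = ennreal (integral\<^sup>L torus bound)"
      using bound_nonneg by (intro nn_integral_eq_integral int) auto
    also have "\<dots> \<le> ennreal (K * (S + ?D))"
    proof (rule ennreal_leI)
      have "integral\<^sup>L torus bound = 2 / r2 * ?D + (K1 * (\<integral>x. (norm (grad f x))\<^sup>2 \<partial>torus) + K2 * S)"
        unfolding bound_def
        by (subst Bochner_Integration.integral_add, (rule integrable_mult_right drag)+,
            rule Bochner_Integration.integrable_add, rule integrable_mult_right, rule gf(1), rule const(1),
            subst Bochner_Integration.integral_add, rule integrable_mult_right, rule gf(1), rule const(1))
           (subst const(2), simp only: integral_mult_right_zero)
      also have "\<dots> \<le> 2 / r2 * ?D + (K1 * (196 * S) + K2 * S)"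
        using gf(2) K1 by (intro add_left_mono add_right_mono mult_left_mono)
      also have "\<dots> = 2 / r2 * ?D + (196 * K1 + K2) * S"
        by (simp add: algebra_simps)
      also have "\<dots> \<le> K * ?D + K * S"
        using K1 K2 pos S0 D0 by (intro add_mono mult_right_mono) (auto simp: K_def)
      finally show "integral\<^sup>L torus bound \<le> K * (S + ?D)" by (simp add: algebra_simps)
    qed
    finally show "relative_entropy \<mu> a \<gamma> \<epsilon> r2 \<kappa> r \<rho> w v
        \<le> ennreal (K * (hess_energy (\<lambda>x. ?Z (\<rho> x)) + ?D))"
      by (simp add: S_def f_def[abs_def])
  qed
qed

section \<open>Exponential decay\<close>

text \<open>Gronwall: \<open>F s * exp (C * s)\<close> has nonpositive derivative for positive times
  and is continuous up to time 0.\<close>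

lemma exponential_decay:
  fixes F :: "real \<Rightarrow> real"
  assumes cont: "continuous_on {0..} F" and diff: "\<And>t. 0 < t \<Longrightarrow> F differentiable (at t)"
    and le: "\<And>t. 0 < t \<Longrightarrow> deriv F t + C * F t \<le> 0" and t: "0 \<le> t"
  shows "F t \<le> F 0 * exp (- C * t)"
proof -
  let ?g = "\<lambda>s. F s * exp (C * s)"
  have "?g t \<le> ?g 0"
  proof (rule DERIV_nonpos_imp_decreasing_open[OF t])
    fix s assume s: "0 < s" "s < t"
    have D: "(F has_real_derivative deriv F s) (at s)"
      using diff[OF s(1)] by (simp add: DERIV_deriv_iff_real_differentiable)
    have "(?g has_real_derivative (deriv F s + C * F s) * exp (C * s)) (at s)"
      by (rule derivative_eq_intros D refl)+ (simp add: algebra_simps)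
    moreover have "(deriv F s + C * F s) * exp (C * s) \<le> 0"
      using le[OF s(1)] by (simp add: mult_nonpos_nonneg)
    ultimately show "\<exists>y. (?g has_real_derivative y) (at s) \<and> y \<le> 0" by blast
  next
    show "continuous_on {0..t} ?g"
      by (intro continuous_intros continuous_on_subset[OF cont]) auto
  qed
  then show ?thesis by (simp add: exp_minus field_simps)
qed

text \<open>Serves at vacuum points, which are minima of a nonnegative density: the pressure
  dissipation vanishes there, whatever values the derivatives of the constitutive functions take at
  0.\<close>

lemma Ck_1_grad_eq_0_at_minimum:
  assumes \<rho>: "Ck 1 \<rho>" and min: "\<And>y. \<rho> x \<le> \<rho> y"
  shows "grad \<rho> x = 0"
proof -
  have "(\<lambda>d. grad \<rho> x \<bullet> d) = (\<lambda>d. 0)"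
    using differential_zero_maxmin[of x UNIV \<rho>] Ck_1_derivative[OF \<rho>] min by blast
  then have "grad \<rho> x \<bullet> grad \<rho> x = 0" by (rule fun_cong)
  then show ?thesis by simp
qed

text \<open>The rate depends on the bound \<open>M\<close> for the initial entropy but not on the
  solution, so one rate serves a whole sequence of regularizations.\<close>

lemma regularized_solution_decay:
  assumes \<mu>: "V1 \<mu> lam" "V2 \<mu> \<alpha>1 \<alpha>2"
    and pos: "0 < r" "0 < r2" "0 < \<epsilon>" "0 < \<kappa>" "\<kappa> < 1" "0 < a" "1 \<le> \<gamma>" "0 < C0" "0 < M"
  obtains C where "0 < C" and
    "\<And>\<rho> u v t. \<lbrakk>regularized_solution \<mu> a \<gamma> \<epsilon> r2 \<kappa> C0 r \<rho> u v;
      relative_entropy \<mu> a \<gamma> \<epsilon> r2 \<kappa> r (\<rho> 0) (w_of \<kappa> u v 0) (v 0) \<le> ennreal M; 0 \<le> t\<rbrakk> \<Longrightarrow>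
      relative_entropy \<mu> a \<gamma> \<epsilon> r2 \<kappa> r (\<rho> t) (w_of \<kappa> u v t) (v t)
        \<le> relative_entropy \<mu> a \<gamma> \<epsilon> r2 \<kappa> r (\<rho> 0) (w_of \<kappa> u v 0) (v 0) * ennreal (exp (- C * t))"
proof -
  obtain \<delta> K where \<delta>: "0 < \<delta>" and K: "0 < K" and coercive:
    "\<And>\<rho> u v w. \<lbrakk>Ck 1 \<rho>; Ck 2 (\<lambda>x. Z_fun \<mu> (\<rho> x)); periodic \<rho>; integral cell \<rho> = r;
      \<And>x. v x = (if 0 < \<rho> x then 2 *\<^sub>R grad (\<lambda>y. s_fun \<mu> (\<rho> y)) x else 0);
      \<And>x. w x = u x + \<kappa> *\<^sub>R v x; \<And>x. 0 \<le> \<rho> x;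
      integrable torus (\<lambda>x. r2 * \<rho> x * (norm (u x))\<^sup>2);
      hess_energy (\<lambda>x. Z_fun \<mu> (\<rho> x)) < \<delta>\<rbrakk> \<Longrightarrow>
      relative_entropy \<mu> a \<gamma> \<epsilon> r2 \<kappa> r \<rho> w v
        \<le> ennreal (K * (hess_energy (\<lambda>x. Z_fun \<mu> (\<rho> x)) + (\<integral>x. r2 * \<rho> x * (norm (u x))\<^sup>2 \<partial>torus)))"
    by (rule entropy_le_dissipation_near_constant[OF \<mu> pos(1-5), where a=a and \<gamma>=\<gamma>]) blast
  define e where "e = \<epsilon> * C0"
  have e: "0 < e" using pos by (simp add: e_def)
  \<comment> \<open>One entry for each case. If S < \<delta>, then F \<le> K (S + D) \<le> K (1/e +
    1) (e S + D). Otherwise the dissipation is at least e \<delta>, while F \<le> M.\<close>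
  define C where "C = min (1 / (K * (1 / e + 1))) (e * \<delta> / M)"
  have C: "0 < C" using K e \<delta> pos by (simp add: C_def add_pos_pos)
  show thesis
  proof (rule that[OF C])
    fix \<rho> :: "real \<Rightarrow> real^3 \<Rightarrow> real" and u v :: "real \<Rightarrow> real^3 \<Rightarrow> real^3" and t :: real
    define E where "E t = relative_entropy \<mu> a \<gamma> \<epsilon> r2 \<kappa> r (\<rho> t) (w_of \<kappa> u v t) (v t)" for t
    define F where "F t = enn2real (E t)" for t
    define S where "S t = hess_energy (\<lambda>x. Z_fun \<mu> (\<rho> t x))" for t
    define drag where "drag t x = r2 * \<rho> t x * (norm (u t x))\<^sup>2" for t x
    define pres where "pres t x = deriv \<mu> (\<rho> t x) *
      deriv (deriv (potential (pressure a \<gamma>))) (\<rho> t x) * (norm (grad (\<rho> t) x))\<^sup>2" for t x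
    assume sol: "regularized_solution \<mu> a \<gamma> \<epsilon> r2 \<kappa> C0 r \<rho> u v"
      and init: "relative_entropy \<mu> a \<gamma> \<epsilon> r2 \<kappa> r (\<rho> 0) (w_of \<kappa> u v 0) (v 0) \<le> ennreal M"
      and t: "0 \<le> t"
    note sol' = sol[unfolded regularized_solution_def Let_def, folded E_def, folded F_def, folded drag_def pres_def]
    have reg: "Ck 1 (\<rho> t)" "Ck 2 (\<lambda>x. Z_fun \<mu> (\<rho> t x))" "periodic (\<rho> t)" "\<And>x. 0 \<le> \<rho> t x"
      "integral cell (\<rho> t) = r" "E t < \<infinity>"
      "\<And>x. v t x = (if 0 < \<rho> t x then 2 *\<^sub>R grad (\<lambda>y. s_fun \<mu> (\<rho> t y)) x else 0)"
      if "0 \<le> t" for t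
    proof -
      show "Ck 1 (\<rho> t)" "Ck 2 (\<lambda>x. Z_fun \<mu> (\<rho> t x))" "periodic (\<rho> t)" "\<And>x. 0 \<le> \<rho> t x"
        "E t < \<infinity>"
        "\<And>x. v t x = (if 0 < \<rho> t x then 2 *\<^sub>R grad (\<lambda>y. s_fun \<mu> (\<rho> t y)) x else 0)"
        using sol' that by blast+
      have "integral\<^sup>L torus (\<rho> t) = r" using sol' that by blast
      then show "integral cell (\<rho> t) = r"
        using integral_torus_continuous(2)[OF Ck_1_continuous[OF \<open>Ck 1 (\<rho> t)\<close>]] by simp
    qed
    have cont: "continuous_on {0..} F"
      and diff: "\<And>t. 0 < t \<Longrightarrow> F differentiable (at t)"
      and int: "\<And>t. 0 < t \<Longrightarrow> integrable torus (drag t)"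
      using sol' by (auto simp: F_def[abs_def])
    have E_eq: "E t = ennreal (F t)" if "0 \<le> t" for t
      using reg(6)[OF that] by (simp add: F_def)
    have F0: "0 \<le> F t" for t by (simp add: F_def)
    have S0: "0 \<le> S t" if "0 \<le> t" for t
      unfolding S_def using reg(2) that by (intro hess_energy_nonneg)
    have D0: "0 \<le> (\<integral>x. drag t x \<partial>torus)" if "0 \<le> t" for t
      using reg(4)[OF that] pos by (intro Bochner_Integration.integral_nonneg) (auto simp: drag_def)
    have pres0: "0 \<le> (\<integral>x. pres t x \<partial>torus)" if t: "0 \<le> t" for t
    proof (rule Bochner_Integration.integral_nonneg)
      fix x
      show "0 \<le> pres t x"
      proof (cases "\<rho> t x = 0")
        case True
        then show ?thesis
          using Ck_1_grad_eq_0_at_minimum[OF reg(1)[OF t], of x] reg(4)[OF t] by (simp add: pres_def)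
      next
        case False
        then have p: "0 < \<rho> t x" using reg(4)[OF t, of x] by simp
        have "0 \<le> a * \<gamma> * \<rho> t x powr (\<gamma> - 1) / \<rho> t x"
          using pos p by simp
        then have "0 \<le> deriv (deriv (potential (pressure a \<gamma>))) (\<rho> t x)"
          using DERIV_imp_deriv[OF deriv_potential_has_derivative[OF pressure_facts(2) p, of a \<gamma>]]
            pressure_facts(4)[OF p, of a \<gamma>] by simp
        then show ?thesis
          using viscosity_facts(5)[OF \<mu> p] by (simp add: pres_def)
      qed
    qed
    have dissip: "deriv F t + e * S t + (\<integral>x. drag t x \<partial>torus) \<le> 0" if t: "0 < t" for t
    proof -
      have "(\<integral>x. (norm (hess (\<lambda>y. Z_fun \<mu> (\<rho> t y)) x))\<^sup>2 \<partial>torus) = S t"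
        unfolding S_def hess_energy_def using t
        by (intro integral_torus_continuous continuous_intros continuous_on_hess reg(2)) auto
      moreover have "0 \<le> \<kappa> * (\<integral>x. pres t x \<partial>torus)"
        using pres0 t pos by simp
      moreover have "deriv F t + \<epsilon> * C0 * (\<integral>x. (norm (hess (\<lambda>y. Z_fun \<mu> (\<rho> t y)) x))\<^sup>2 \<partial>torus)
          + \<kappa> * (\<integral>x. pres t x \<partial>torus) + (\<integral>x. drag t x \<partial>torus) \<le> 0"
        using sol' t by (simp add: F_def[abs_def])
      ultimately show ?thesis by (simp add: e_def)
    qed
    have F_le: "F t \<le> M" if t: "0 \<le> t" for t
    proof -
      \<comment> \<open>Decay at rate 0, that is, monotonicity of the entropy.\<close>
      have "F t \<le> F 0 * exp (- 0 * t)"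
      proof (rule exponential_decay[OF cont diff _ t])
        fix s :: real assume s: "0 < s"
        have "0 \<le> e * S s" using e S0 s by simp
        then show "deriv F s + 0 * F s \<le> 0" using dissip[OF s] D0[of s] s by simp
      qed
      moreover have "F 0 \<le> M"
        using init pos E_eq[of 0] by (simp add: E_def)
      ultimately show ?thesis by simp
    qed
    have "F t \<le> F 0 * exp (- C * t)"
    proof (rule exponential_decay[OF cont diff _ t])
      fix s :: real assume s: "0 < s"
      then have s0: "0 \<le> s" by simp
      let ?D = "\<integral>x. drag s x \<partial>torus"
      have "C * F s \<le> e * S s + ?D"
      proof (cases "S s < \<delta>")
        case True
        have "E s \<le> ennreal (K * (S s + ?D))"
          unfolding E_def S_def drag_def
          by (intro coercive reg s0) (use True s int[OF s] in \<open>auto simp: w_of_def S_def drag_def[abs_def]\<close>)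
        then have "F s \<le> K * (S s + ?D)"
          using E_eq[OF s0] K S0[OF s0] D0[OF s0] by simp
        also have "\<dots> \<le> K * (1 / e + 1) * (e * S s + ?D)"
          using K e S0[OF s0] D0[OF s0] by (simp add: field_simps)
        finally have "C * F s \<le> 1 / (K * (1 / e + 1)) * (K * (1 / e + 1) * (e * S s + ?D))"
          using C K e F0 by (intro mult_mono) (auto simp: C_def)
        also have "\<dots> = e * S s + ?D"
          using K e by (simp add: add_pos_pos less_imp_neq[symmetric])
        finally show ?thesis .
      next
        case False
        have "C * F s \<le> e * \<delta> / M * M"
          using C F_le[OF s0] F0 e \<delta> pos by (intro mult_mono) (auto simp: C_def)
        also have "\<dots> = e * \<delta>" using pos by simp
        also have "\<dots> \<le> e * S s" using False e by (intro mult_left_mono) auto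
        finally show ?thesis using D0[OF s0] by simp
      qed
      then show "deriv F s + C * F s \<le> 0" using dissip[OF s] by simp
    qed
    then have "ennreal (F t) \<le> ennreal (F 0) * ennreal (exp (- C * t))"
      using F0 by (simp add: ennreal_mult[symmetric])
    then show "relative_entropy \<mu> a \<gamma> \<epsilon> r2 \<kappa> r (\<rho> t) (w_of \<kappa> u v t) (v t)
        \<le> relative_entropy \<mu> a \<gamma> \<epsilon> r2 \<kappa> r (\<rho> 0) (w_of \<kappa> u v 0) (v 0) * ennreal (exp (- C * t))"
      using E_eq t by (simp add: E_def)
  qed
qed

section \<open>Passage to the limit\<close>

theorem theorem5:
  fixes \<mu> lam :: "real \<Rightarrow> real"
    and a \<gamma> \<epsilon> r2 \<alpha>1 \<alpha>2 \<nu> \<kappa> r :: real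
    and \<rho>0 :: "real^3 \<Rightarrow> real" and m0 w0 v0 :: "real^3 \<Rightarrow> real^3"
    and \<rho> :: "real \<Rightarrow> real^3 \<Rightarrow> real" and u v :: "real \<Rightarrow> real^3 \<Rightarrow> real^3"
  assumes "0 < \<epsilon>" and "0 < r2" and "0 < a" and "1 \<le> \<gamma>"
    and "V1 \<mu> lam" and "V2 \<mu> \<alpha>1 \<alpha>2" and "V3 \<mu>" and "V4 \<mu> \<gamma>" and "V5 \<mu>"
    and "0 < \<nu>" and "\<forall>y\<ge>0. \<nu> * \<mu> y \<le> lam y + 2/3 * \<mu> y"
    and "global_weak_solution \<mu> lam a \<gamma> \<epsilon> r2 \<nu> \<kappa> r \<rho>0 m0 w0 v0 \<rho> u v"
    and "\<forall>t\<ge>0. r = (\<integral>x. \<rho> t x \<partial>torus)" and "0 < r"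
  shows "\<exists>C>0. \<forall>t>0.
    relative_entropy \<mu> a \<gamma> \<epsilon> r2 \<kappa> r (\<rho> t) (w_of \<kappa> u v t) (v t)
      \<le> relative_entropy \<mu> a \<gamma> \<epsilon> r2 \<kappa> r (\<rho> 0) (w_of \<kappa> u v 0) (v 0) * ennreal (exp (- C * t))"
proof -
  define E where "E t = relative_entropy \<mu> a \<gamma> \<epsilon> r2 \<kappa> r (\<rho> t) (w_of \<kappa> u v t) (v t)" for t
  have \<kappa>: "0 < \<kappa>" "\<kappa> < 1"
    using assms(12) unfolding global_weak_solution_def by blast+
  obtain C0 where C0: "0 < C0" and lim: "limit_of_regularized \<mu> a \<gamma> \<epsilon> r2 \<kappa> C0 r \<rho>0 w0 v0 \<rho> u v"
    using assms(12) unfolding global_weak_solution_def by blast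
  obtain \<zeta> :: "nat \<Rightarrow> real" and \<rho>\<zeta> u\<zeta> v\<zeta> where
    sol: "\<And>n. regularized_solution \<mu> a \<gamma> \<epsilon> r2 \<kappa> C0 r (\<rho>\<zeta> (\<zeta> n)) (u\<zeta> (\<zeta> n)) (v\<zeta> (\<zeta> n))"
    and init: "(\<lambda>n. relative_entropy \<mu> a \<gamma> \<epsilon> r2 \<kappa> r (\<rho>\<zeta> (\<zeta> n) 0)
       (w_of \<kappa> (u\<zeta> (\<zeta> n)) (v\<zeta> (\<zeta> n)) 0) (v\<zeta> (\<zeta> n) 0)) \<longlonglongrightarrow> E 0"
    and lsc: "\<And>t. 0 < t \<Longrightarrow> E t \<le> liminf (\<lambda>n. relative_entropy \<mu> a \<gamma> \<epsilon> r2 \<kappa> r (\<rho>\<zeta> (\<zeta> n) t)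
       (w_of \<kappa> (u\<zeta> (\<zeta> n)) (v\<zeta> (\<zeta> n)) t) (v\<zeta> (\<zeta> n) t))"
    using lim unfolding limit_of_regularized_def Let_def E_def by blast
  define En where "En n t = relative_entropy \<mu> a \<gamma> \<epsilon> r2 \<kappa> r (\<rho>\<zeta> (\<zeta> n) t)
       (w_of \<kappa> (u\<zeta> (\<zeta> n)) (v\<zeta> (\<zeta> n)) t) (v\<zeta> (\<zeta> n) t)" for n t
  have "\<exists>C>0. \<forall>t>0. E t \<le> E 0 * ennreal (exp (- C * t))"
  \<comment> \<open>The entropy is extended-valued; if it is infinite initially, so is the
    right-hand side, the exponential factor being positive.\<close>
  proof (cases "E 0 = \<infinity>")
    case True
    then show ?thesis by (intro exI[of _ 1]) (simp add: ennreal_top_mult)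
  next
    case False
    \<comment> \<open>The added 1 makes \<open>M\<close> strictly larger than \<open>E 0\<close>, so
      the converging initial entropies are eventually below \<open>M\<close>.\<close>
    define M where "M = enn2real (E 0) + 1"
    have M: "0 < M" by (simp add: M_def add_nonneg_pos)
    have "E 0 < ennreal M"
      using False by (cases "E 0") (auto simp: M_def ennreal_less_iff)
    then have bounded: "\<forall>\<^sub>F n in sequentially. En n 0 \<le> ennreal M"
      using order_tendstoD(2)[OF init, of "ennreal M"] unfolding En_def
      by (auto elim!: eventually_mono)
    obtain C where C: "0 < C" and decay:
      "\<And>\<rho> u v t. \<lbrakk>regularized_solution \<mu> a \<gamma> \<epsilon> r2 \<kappa> C0 r \<rho> u v;
        relative_entropy \<mu> a \<gamma> \<epsilon> r2 \<kappa> r (\<rho> 0) (w_of \<kappa> u v 0) (v 0) \<le> ennreal M; 0 \<le> t\<rbrakk> \<Longrightarrow>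
        relative_entropy \<mu> a \<gamma> \<epsilon> r2 \<kappa> r (\<rho> t) (w_of \<kappa> u v t) (v t)
          \<le> relative_entropy \<mu> a \<gamma> \<epsilon> r2 \<kappa> r (\<rho> 0) (w_of \<kappa> u v 0) (v 0) * ennreal (exp (- C * t))"
      by (rule regularized_solution_decay[OF assms(5,6,14,2,1) \<kappa> assms(3,4) C0 M]) blast
    have "E t \<le> E 0 * ennreal (exp (- C * t))" if t: "0 < t" for t
    proof -
      have "\<forall>\<^sub>F n in sequentially. En n t \<le> En n 0 * ennreal (exp (- C * t))"
        using bounded
      proof eventually_elim
        case (elim n)
        then show ?case unfolding En_def by (intro decay sol) (use t in auto)
      qed
      then have "liminf (\<lambda>n. En n t) \<le> liminf (\<lambda>n. En n 0 * ennreal (exp (- C * t)))"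
        by (rule Liminf_mono)
      \<comment> \<open>The initial entropies converge and the factor is finite, so this lower limit
        is a genuine limit.\<close>
      also have "\<dots> = E 0 * ennreal (exp (- C * t))"
      proof (rule lim_imp_Liminf[OF sequentially_bot])
        have "(\<lambda>n. ennreal (exp (- C * t)) * En n 0) \<longlonglongrightarrow> ennreal (exp (- C * t)) * E 0"
          using init unfolding En_def by (intro ennreal_tendsto_cmult) auto
        then show "(\<lambda>n. En n 0 * ennreal (exp (- C * t))) \<longlonglongrightarrow> E 0 * ennreal (exp (- C * t))"
          by (simp add: mult.commute)
      qed
      finally show ?thesis using lsc[OF t] unfolding En_def by (rule order_trans[rotated])
    qed
    with C show ?thesis by blast
  qed
  then show ?thesis by (simp add: E_def)
qed

end
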